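(* The theory $\mathbf{SPOT}$ is a conservative extension of $\mathbf{ZF}$; that is, for every sentence $\theta$ in the $\in$-language, if $\mathbf{SPOT}\vdash\theta$ then $\mathbf{ZF}\vdash\theta$.
   Context: The $\mathrm{st}$-$\in$-language extends the $\in$-language of set theory by a unary predicate $\mathrm{st}$ ($\mathrm{st}(x)$ reads "$x$ is standard"). An $\in$-formula is a formula not involving $\mathrm{st}$; an $\mathrm{st}$-$\in$-formula may involve it. $\forall^{\mathrm{st}}$ and $\exists^{\mathrm{st}}$ are quantifiers over standard sets. $\mathbf{ZF}$ is Zermelo–Fraenkel set theory without Choice (when part of a theory in the $\mathrm{st}$-$\in$-language, its Separation and Replacement schemas are for $\in$-formulas only). $\mathbb N$ is the set of natural numbers. $\mathbf{SPOT}$ is the theory in the $\mathrm{st}$-$\in$-language with the axioms: - $\mathbf{ZF}$; - Transfer ($\mathbf T$): for each $\in$-formula $\phi$ with standard parameters, $\forall^{\mathrm{st}}x\,\phi(x)\rightarrow\forall x\,\phi(x)$; - Nontriviality ($\mathbf O$): $\exists\nu\in\mathbb N\ \forall^{\mathrm{st}}n\in\mathbb N\ (n\neq\nu)$; - Standard Part ($\mathbf{SP}'$): $\forall A\subseteq\mathbb N\ \exists^{\mathrm{st}}B\subseteq\mathbb N\ \forall^{\mathrm{st}}n\in\mathbb N\ (n\in B\leftrightarrow n\in A)$. *)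

theory Defs
  imports Main
begin

section \<open>Formulas of the st-\<open>\<in>\<close>-language\<close>

text \<open>Variables are de Bruijn indices; there are no function symbols, so variables are the
  only terms. The classical connectives other than implication are abbreviations.\<close>

datatype fm =
    Mem nat nat  (infix \<open>\<^bold>\<in>\<close> 70)
  | Eq nat nat   (infix \<open>\<^bold>=\<close> 70)
  | St nat
  | Fls          (\<open>\<^bold>\<bottom>\<close>)
  | Imp fm fm    (infixr \<open>\<^bold>\<longrightarrow>\<close> 55)
  | Forall fm

abbreviation Neg :: "fm \<Rightarrow> fm" (\<open>\<^bold>\<not> _\<close> [65] 65)
  where "\<^bold>\<not> \<phi> \<equiv> \<phi> \<^bold>\<longrightarrow> \<^bold>\<bottom>"

abbreviation Conj :: "fm \<Rightarrow> fm \<Rightarrow> fm" (infixr \<open>\<^bold>\<and>\<close> 60)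
  where "\<phi> \<^bold>\<and> \<psi> \<equiv> \<^bold>\<not> (\<phi> \<^bold>\<longrightarrow> \<^bold>\<not> \<psi>)"

abbreviation Disj :: "fm \<Rightarrow> fm \<Rightarrow> fm" (infixr \<open>\<^bold>\<or>\<close> 58)
  where "\<phi> \<^bold>\<or> \<psi> \<equiv> \<^bold>\<not> \<phi> \<^bold>\<longrightarrow> \<psi>"

abbreviation Iff :: "fm \<Rightarrow> fm \<Rightarrow> fm" (infix \<open>\<^bold>\<longleftrightarrow>\<close> 53)
  where "\<phi> \<^bold>\<longleftrightarrow> \<psi> \<equiv> (\<phi> \<^bold>\<longrightarrow> \<psi>) \<^bold>\<and> (\<psi> \<^bold>\<longrightarrow> \<phi>)"

abbreviation Exists :: "fm \<Rightarrow> fm"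
  where "Exists \<phi> \<equiv> \<^bold>\<not> Forall (\<^bold>\<not> \<phi>)"

abbreviation ForallSt :: "fm \<Rightarrow> fm"
  where "ForallSt \<phi> \<equiv> Forall (St 0 \<^bold>\<longrightarrow> \<phi>)"

abbreviation ExistsSt :: "fm \<Rightarrow> fm"
  where "ExistsSt \<phi> \<equiv> Exists (St 0 \<^bold>\<and> \<phi>)"

primrec in_fm :: "fm \<Rightarrow> bool" where
  "in_fm (x \<^bold>\<in> y) = True"
| "in_fm (x \<^bold>= y) = True"
| "in_fm (St x) = False"
| "in_fm \<^bold>\<bottom> = True"
| "in_fm (\<phi> \<^bold>\<longrightarrow> \<psi>) = (in_fm \<phi> \<and> in_fm \<psi>)"
| "in_fm (Forall \<phi>) = in_fm \<phi>"

text \<open>\<open>fv_below n \<phi>\<close>: every free variable of \<open>\<phi>\<close> is less than \<open>n\<close>.\<close>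

primrec fv_below :: "nat \<Rightarrow> fm \<Rightarrow> bool" where
  "fv_below n (x \<^bold>\<in> y) = (x < n \<and> y < n)"
| "fv_below n (x \<^bold>= y) = (x < n \<and> y < n)"
| "fv_below n (St x) = (x < n)"
| "fv_below n \<^bold>\<bottom> = True"
| "fv_below n (\<phi> \<^bold>\<longrightarrow> \<psi>) = (fv_below n \<phi> \<and> fv_below n \<psi>)"
| "fv_below n (Forall \<phi>) = fv_below (Suc n) \<phi>"

definition sentence :: "fm \<Rightarrow> bool" where
  "sentence \<phi> \<longleftrightarrow> fv_below 0 \<phi>"

text \<open>Simultaneous capture-avoiding substitution of the variable \<open>f x\<close> for each free
  variable \<open>x\<close>.\<close>

primrec subst :: "(nat \<Rightarrow> nat) \<Rightarrow> fm \<Rightarrow> fm" where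
  "subst f (x \<^bold>\<in> y) = (f x \<^bold>\<in> f y)"
| "subst f (x \<^bold>= y) = (f x \<^bold>= f y)"
| "subst f (St x) = St (f x)"
| "subst f \<^bold>\<bottom> = \<^bold>\<bottom>"
| "subst f (\<phi> \<^bold>\<longrightarrow> \<psi>) = (subst f \<phi> \<^bold>\<longrightarrow> subst f \<psi>)"
| "subst f (Forall \<phi>) = Forall (subst (case_nat 0 (\<lambda>x. Suc (f x))) \<phi>)"

text \<open>\<open>inst t \<phi>\<close> is the body \<open>\<phi>\<close> of a quantifier with the bound variable replaced by \<open>t\<close>.\<close>

definition inst :: "nat \<Rightarrow> fm \<Rightarrow> fm" where
  "inst t = subst (case_nat t (\<lambda>x. x))"


section \<open>Provability\<close>

text \<open>Natural deduction for classical first-order logic with equality, all formulas of a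
  derivation being taken from the language \<open>L\<close>. Applying \<open>subst Suc\<close> to the assumptions in
  \<open>ForallI\<close> frees the variable \<open>0\<close>; this is the eigenvariable condition.\<close>

inductive derives :: "fm set \<Rightarrow> fm set \<Rightarrow> fm \<Rightarrow> bool" for L :: "fm set" where
  Assm: "\<phi> \<in> \<Gamma> \<Longrightarrow> \<phi> \<in> L \<Longrightarrow> derives L \<Gamma> \<phi>"
| ImpI: "\<phi> \<in> L \<Longrightarrow> derives L (insert \<phi> \<Gamma>) \<psi> \<Longrightarrow> derives L \<Gamma> (\<phi> \<^bold>\<longrightarrow> \<psi>)"
| ImpE: "derives L \<Gamma> (\<phi> \<^bold>\<longrightarrow> \<psi>) \<Longrightarrow> derives L \<Gamma> \<phi> \<Longrightarrow> derives L \<Gamma> \<psi>"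
| Classical: "\<phi> \<in> L \<Longrightarrow> derives L (insert (\<^bold>\<not> \<phi>) \<Gamma>) \<^bold>\<bottom> \<Longrightarrow> derives L \<Gamma> \<phi>"
| ForallI: "derives L (subst Suc ` \<Gamma>) \<phi> \<Longrightarrow> derives L \<Gamma> (Forall \<phi>)"
| ForallE: "derives L \<Gamma> (Forall \<phi>) \<Longrightarrow> derives L \<Gamma> (inst t \<phi>)"
| EqRefl: "derives L \<Gamma> (x \<^bold>= x)"
| EqSubst: "derives L \<Gamma> (x \<^bold>= y) \<Longrightarrow> derives L \<Gamma> (inst x \<phi>) \<Longrightarrow> derives L \<Gamma> (inst y \<phi>)"

abbreviation proves_in :: "fm set \<Rightarrow> fm \<Rightarrow> bool" (infix \<open>\<turnstile>\<^sub>\<in>\<close> 50)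
  where "T \<turnstile>\<^sub>\<in> \<phi> \<equiv> derives {\<psi>. in_fm \<psi>} T \<phi>"

abbreviation proves_st :: "fm set \<Rightarrow> fm \<Rightarrow> bool" (infix \<open>\<turnstile>\<^sub>s\<^sub>t\<close> 50)
  where "T \<turnstile>\<^sub>s\<^sub>t \<phi> \<equiv> derives UNIV T \<phi>"


section \<open>The axioms of ZF\<close>

definition Extensionality :: fm where
  "Extensionality = Forall (Forall (Forall (0 \<^bold>\<in> 2 \<^bold>\<longleftrightarrow> 0 \<^bold>\<in> 1) \<^bold>\<longrightarrow> 1 \<^bold>= 0))"

definition Foundation :: fm where
  "Foundation = Forall (Exists (0 \<^bold>\<in> 1) \<^bold>\<longrightarrow> Exists (0 \<^bold>\<in> 1 \<^bold>\<and> Forall (0 \<^bold>\<in> 2 \<^bold>\<longrightarrow> \<^bold>\<not> 0 \<^bold>\<in> 1)))"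

definition Pairing :: fm where
  "Pairing = Forall (Forall (Exists (Forall (0 \<^bold>\<in> 1 \<^bold>\<longleftrightarrow> 0 \<^bold>= 3 \<^bold>\<or> 0 \<^bold>= 2))))"

definition Union_Set :: fm where
  "Union_Set = Forall (Exists (Forall (0 \<^bold>\<in> 1 \<^bold>\<longleftrightarrow> Exists (0 \<^bold>\<in> 3 \<^bold>\<and> 1 \<^bold>\<in> 0))))"

definition subset_fm :: "nat \<Rightarrow> nat \<Rightarrow> fm" where
  "subset_fm x y = Forall (0 \<^bold>\<in> Suc x \<^bold>\<longrightarrow> 0 \<^bold>\<in> Suc y)"

definition Power_Set :: fm where
  "Power_Set = Forall (Exists (Forall (0 \<^bold>\<in> 1 \<^bold>\<longleftrightarrow> subset_fm 0 2)))"

definition empty_fm :: "nat \<Rightarrow> fm" where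
  "empty_fm x = Forall (\<^bold>\<not> 0 \<^bold>\<in> Suc x)"

text \<open>\<open>y = x \<union> {x}\<close>\<close>

definition succ_fm :: "nat \<Rightarrow> nat \<Rightarrow> fm" where
  "succ_fm x y = Forall (0 \<^bold>\<in> Suc y \<^bold>\<longleftrightarrow> 0 \<^bold>\<in> Suc x \<^bold>\<or> 0 \<^bold>= Suc x)"

definition inductive_fm :: "nat \<Rightarrow> fm" where
  "inductive_fm I = Exists (empty_fm 0 \<^bold>\<and> 0 \<^bold>\<in> Suc I) \<^bold>\<and>
     Forall (0 \<^bold>\<in> Suc I \<^bold>\<longrightarrow> Exists (succ_fm 1 0 \<^bold>\<and> 0 \<^bold>\<in> Suc (Suc I)))"

definition Infinity :: fm where
  "Infinity = Exists (inductive_fm 0)"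

text \<open>In the schemas, the parameters are the \<open>n\<close> variables bound by \<open>Forall ^^ n\<close>.

  Separation, for \<open>\<phi>(x, parameters)\<close> with \<open>x\<close> the variable \<open>0\<close>:
  \<open>\<forall>A \<exists>B \<forall>x (x \<in> B \<longleftrightarrow> x \<in> A \<and> \<phi>(x))\<close>.

  Replacement, for \<open>\<phi>(x, y, parameters)\<close> with \<open>x\<close>, \<open>y\<close> the variables \<open>0\<close>, \<open>1\<close>:
  \<open>\<forall>A ((\<forall>x \<in> A. \<forall>y z. \<phi>(x, y) \<and> \<phi>(x, z) \<longrightarrow> y = z) \<longrightarrow> (\<exists>B \<forall>y (y \<in> B \<longleftrightarrow> (\<exists>x \<in> A. \<phi>(x, y)))))\<close>.

  The substitutions skip the variables \<open>A\<close>, \<open>B\<close>, etc., which therefore are not free in \<open>\<phi>\<close>.\<close>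

definition separation_fm :: "fm \<Rightarrow> fm" where
  "separation_fm \<phi> = Forall (Exists (Forall
     (0 \<^bold>\<in> 1 \<^bold>\<longleftrightarrow> 0 \<^bold>\<in> 2 \<^bold>\<and> subst (case_nat 0 (\<lambda>p. p + 3)) \<phi>)))"

definition Separation :: "fm set" where
  "Separation = {(Forall ^^ n) (separation_fm \<phi>) | n \<phi>. in_fm \<phi> \<and> fv_below (n + 1) \<phi>}"

definition replacement_fm :: "fm \<Rightarrow> fm" where
  "replacement_fm \<phi> = Forall (
     Forall (0 \<^bold>\<in> 1 \<^bold>\<longrightarrow> Forall (Forall
       (subst (case_nat 2 (case_nat 1 (\<lambda>p. p + 4))) \<phi> \<^bold>\<and>
        subst (case_nat 2 (case_nat 0 (\<lambda>p. p + 4))) \<phi> \<^bold>\<longrightarrow> 1 \<^bold>= 0))) \<^bold>\<longrightarrow>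
     Exists (Forall (0 \<^bold>\<in> 1 \<^bold>\<longleftrightarrow>
       Exists (0 \<^bold>\<in> 3 \<^bold>\<and> subst (case_nat 0 (case_nat 1 (\<lambda>p. p + 4))) \<phi>))))"

definition Replacement :: "fm set" where
  "Replacement = {(Forall ^^ n) (replacement_fm \<phi>) | n \<phi>. in_fm \<phi> \<and> fv_below (n + 2) \<phi>}"

definition ZF :: "fm set" where
  "ZF = {Extensionality, Foundation, Pairing, Union_Set, Power_Set, Infinity}
        \<union> Separation \<union> Replacement"


section \<open>The axioms of SPOT\<close>

text \<open>\<open>\<nat>\<close> is the least inductive set: \<open>x \<in> \<nat>\<close> iff \<open>x\<close> belongs to every inductive set.\<close>

definition nat_fm :: "nat \<Rightarrow> fm" where
  "nat_fm x = Forall (inductive_fm 0 \<^bold>\<longrightarrow> Suc x \<^bold>\<in> 0)"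

definition subset_nat_fm :: "nat \<Rightarrow> fm" where
  "subset_nat_fm A = Forall (0 \<^bold>\<in> Suc A \<^bold>\<longrightarrow> nat_fm 0)"

definition Transfer :: "fm set" where
  "Transfer = {(ForallSt ^^ n) (ForallSt \<phi> \<^bold>\<longrightarrow> Forall \<phi>) | n \<phi>. in_fm \<phi> \<and> fv_below (n + 1) \<phi>}"

definition Nontriviality :: fm where
  "Nontriviality = Exists (nat_fm 0 \<^bold>\<and> ForallSt (nat_fm 0 \<^bold>\<longrightarrow> \<^bold>\<not> 0 \<^bold>= 1))"

definition Standard_Part :: fm where
  "Standard_Part = Forall (subset_nat_fm 0 \<^bold>\<longrightarrow>
     ExistsSt (subset_nat_fm 0 \<^bold>\<and> ForallSt (nat_fm 0 \<^bold>\<longrightarrow> (0 \<^bold>\<in> 1 \<^bold>\<longleftrightarrow> 0 \<^bold>\<in> 2))))"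

definition SPOT :: "fm set" where
  "SPOT = ZF \<union> Transfer \<union> {Nontriviality, Standard_Part}"


section \<open>The meaning of the axioms in a structure\<close>

text \<open>Not used in the definition of provability; the lemmas spell out, in named variables,
  what the de Bruijn formulas above say in a structure with membership \<open>E\<close> and
  standardness \<open>S\<close>.\<close>

primrec sat :: "('a \<Rightarrow> 'a \<Rightarrow> bool) \<Rightarrow> ('a \<Rightarrow> bool) \<Rightarrow> (nat \<Rightarrow> 'a) \<Rightarrow> fm \<Rightarrow> bool" where
  "sat E S e (x \<^bold>\<in> y) = E (e x) (e y)"
| "sat E S e (x \<^bold>= y) = (e x = e y)"
| "sat E S e (St x) = S (e x)"
| "sat E S e \<^bold>\<bottom> = False"
| "sat E S e (\<phi> \<^bold>\<longrightarrow> \<psi>) = (sat E S e \<phi> \<longrightarrow> sat E S e \<psi>)"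
| "sat E S e (Forall \<phi>) = (\<forall>a. sat E S (case_nat a e) \<phi>)"

lemma connectives:
  "(P \<longrightarrow> False) \<longleftrightarrow> \<not> P"
  "\<not> (P \<longrightarrow> \<not> Q) \<longleftrightarrow> P \<and> Q"
  "(\<not> P \<longrightarrow> Q) \<longleftrightarrow> P \<or> Q"
  "(P \<longrightarrow> Q) \<and> (Q \<longrightarrow> P) \<longleftrightarrow> (P \<longleftrightarrow> Q)"
  "\<not> (\<forall>x. \<not> R x) \<longleftrightarrow> (\<exists>x. R x)"
  by auto

lemma sat_subst: "sat E S e (subst f \<phi>) = sat E S (\<lambda>x. e (f x)) \<phi>"
proof (induction \<phi> arbitrary: e f)
  case (Forall \<phi>)
  have "(\<lambda>x. case_nat a e (case_nat 0 (\<lambda>x. Suc (f x)) x)) = case_nat a (\<lambda>x. e (f x))" for a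
    by (auto simp: fun_eq_iff split: nat.split)
  then show ?case by (simp add: Forall)
qed simp_all

lemma case_nat_numeral: "case_nat a e (numeral k) = e (pred_numeral k)"
  by (simp add: numeral_eq_Suc)

lemma sat_Extensionality:
  "sat E S e Extensionality \<longleftrightarrow> (\<forall>x y. (\<forall>z. E z x \<longleftrightarrow> E z y) \<longrightarrow> x = y)"
  by (simp only: Extensionality_def sat.simps connectives, simp add: case_nat_numeral)

lemma sat_Foundation:
  "sat E S e Foundation \<longleftrightarrow> (\<forall>x. (\<exists>y. E y x) \<longrightarrow> (\<exists>y. E y x \<and> (\<forall>z. E z x \<longrightarrow> \<not> E z y)))"
  by (simp only: Foundation_def sat.simps connectives, simp add: case_nat_numeral)

lemma sat_Pairing:
  "sat E S e Pairing \<longleftrightarrow> (\<forall>x y. \<exists>p. \<forall>z. E z p \<longleftrightarrow> z = x \<or> z = y)"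
  by (simp only: Pairing_def sat.simps connectives, simp add: case_nat_numeral)

lemma sat_Union_Set:
  "sat E S e Union_Set \<longleftrightarrow> (\<forall>x. \<exists>u. \<forall>z. E z u \<longleftrightarrow> (\<exists>y. E y x \<and> E z y))"
  by (simp only: Union_Set_def sat.simps connectives, simp add: case_nat_numeral)

lemma sat_subset_fm: "sat E S e (subset_fm x y) \<longleftrightarrow> (\<forall>z. E z (e x) \<longrightarrow> E z (e y))"
  by (simp only: subset_fm_def sat.simps connectives, simp)

lemma sat_Power_Set:
  "sat E S e Power_Set \<longleftrightarrow> (\<forall>x. \<exists>p. \<forall>z. E z p \<longleftrightarrow> (\<forall>w. E w z \<longrightarrow> E w x))"
  by (simp only: Power_Set_def sat.simps connectives, simp add: sat_subset_fm case_nat_numeral)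

definition is_inductive :: "('a \<Rightarrow> 'a \<Rightarrow> bool) \<Rightarrow> 'a \<Rightarrow> bool" where
  "is_inductive E I \<longleftrightarrow> (\<exists>o'. (\<forall>z. \<not> E z o') \<and> E o' I) \<and>
     (\<forall>x. E x I \<longrightarrow> (\<exists>y. (\<forall>z. E z y \<longleftrightarrow> E z x \<or> z = x) \<and> E y I))"

lemma sat_inductive_fm: "sat E S e (inductive_fm I) \<longleftrightarrow> is_inductive E (e I)"
  by (simp only: inductive_fm_def empty_fm_def succ_fm_def sat.simps connectives,
      simp add: is_inductive_def)

lemma sat_Infinity: "sat E S e Infinity \<longleftrightarrow> (\<exists>I. is_inductive E I)"
  by (simp only: Infinity_def sat.simps connectives, simp add: sat_inductive_fm)

lemma sat_separation_fm:
  "sat E S e (separation_fm \<phi>) \<longleftrightarrow>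
     (\<forall>A. \<exists>B. \<forall>x. E x B \<longleftrightarrow> E x A \<and> sat E S (case_nat x e) \<phi>)"
proof -
  have "(\<lambda>v. case_nat x (case_nat B (case_nat A e)) (case_nat 0 (\<lambda>p. p + 3) v)) = case_nat x e"
    for x B A by (auto simp: fun_eq_iff numeral_eq_Suc split: nat.split)
  then show ?thesis
    by (simp only: separation_fm_def sat.simps connectives, simp add: sat_subst case_nat_numeral)
qed

lemma sat_replacement_fm:
  "sat E S e (replacement_fm \<phi>) \<longleftrightarrow>
     (\<forall>A. (\<forall>x. E x A \<longrightarrow> (\<forall>y z. sat E S (case_nat x (case_nat y e)) \<phi> \<and>
                              sat E S (case_nat x (case_nat z e)) \<phi> \<longrightarrow> y = z)) \<longrightarrow>
          (\<exists>B. \<forall>y. E y B \<longleftrightarrow> (\<exists>x. E x A \<and> sat E S (case_nat x (case_nat y e)) \<phi>)))"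
proof -
  have "(\<lambda>v. case_nat z (case_nat y (case_nat x (case_nat A e)))
          (case_nat 2 (case_nat (Suc 0) (\<lambda>p. p + 4)) v)) = case_nat x (case_nat y e)"
    and "(\<lambda>v. case_nat z (case_nat y (case_nat x (case_nat A e)))
          (case_nat 2 (case_nat 0 (\<lambda>p. p + 4)) v)) = case_nat x (case_nat z e)"
    and "(\<lambda>v. case_nat x (case_nat y (case_nat B (case_nat A e)))
          (case_nat 0 (case_nat (Suc 0) (\<lambda>p. p + 4)) v)) = case_nat x (case_nat y e)"
    for x y z A B by (auto simp: fun_eq_iff numeral_eq_Suc split: nat.split)
  then show ?thesis
    by (simp only: replacement_fm_def sat.simps connectives, simp add: sat_subst case_nat_numeral)
qed

definition is_nat :: "('a \<Rightarrow> 'a \<Rightarrow> bool) \<Rightarrow> 'a \<Rightarrow> bool" where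
  "is_nat E x \<longleftrightarrow> (\<forall>I. is_inductive E I \<longrightarrow> E x I)"

lemma sat_nat_fm: "sat E S e (nat_fm x) \<longleftrightarrow> is_nat E (e x)"
  by (simp only: nat_fm_def sat.simps connectives, simp add: is_nat_def sat_inductive_fm)

lemma sat_Nontriviality:
  "sat E S e Nontriviality \<longleftrightarrow> (\<exists>\<nu>. is_nat E \<nu> \<and> (\<forall>n. S n \<longrightarrow> is_nat E n \<longrightarrow> n \<noteq> \<nu>))"
  by (simp only: Nontriviality_def sat.simps connectives, simp add: sat_nat_fm)

lemma sat_Standard_Part:
  "sat E S e Standard_Part \<longleftrightarrow>
     (\<forall>A. (\<forall>n. E n A \<longrightarrow> is_nat E n) \<longrightarrow>
       (\<exists>B. S B \<and> (\<forall>n. E n B \<longrightarrow> is_nat E n) \<and>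
            (\<forall>n. S n \<longrightarrow> is_nat E n \<longrightarrow> (E n B \<longleftrightarrow> E n A))))"
  by (simp only: Standard_Part_def subset_nat_fm_def sat.simps connectives,
      simp add: sat_nat_fm case_nat_numeral)

lemma sat_Transfer_instance:
  "sat E S e (ForallSt \<phi> \<^bold>\<longrightarrow> Forall \<phi>) \<longleftrightarrow>
     ((\<forall>x. S x \<longrightarrow> sat E S (case_nat x e) \<phi>) \<longrightarrow> (\<forall>x. sat E S (case_nat x e) \<phi>))"
  by simp

end

theory Submission
  imports Defs "HOL-Library.Countable" "HOL-Library.Infinite_Set"
begin

text \<open>
  Suppose \<open>\<theta>\<close> is a theorem of SPOT and \<open>M\<close> is any model of ZF. Forcing
  over \<open>M\<close> produces a Boolean-valued elementary extension of \<open>M\<close> in which all axioms of SPOT are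
  forced, the elements of \<open>M\<close> being the standard ones. Derivations preserve being forced, and
  for an \<open>\<in>\<close>-sentence being forced is the same as being true in \<open>M\<close>. So \<open>\<theta>\<close> is true in every
  model of ZF, and by the completeness theorem it is derivable from ZF.

  The elements of the extension are named by the natural numbers: number \<open>x\<close> names the \<open>x\<close>-th
  generic element. A condition is a filter base of sets of environments, that is, a decreasing
  family \<open>C k\<close> of nonempty sets of assignments of elements of \<open>M\<close> to the names, indexed by the
  natural numbers \<open>k\<close> of \<open>M\<close> and definable over \<open>M\<close> with parameters. It forces an
  \<open>\<in>\<close>-formula if the formula holds throughout some \<open>C k\<close> (\<open>forces_in_fm\<close>). An ultrapower would
  need choice functions for the existential quantifier in the theorem of Los; here a witness is
  obtained by giving an unused name all possible witnesses as values, so that no choice is made.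

  A condition forces a name to be standard if densely many extensions make the name constant. Transfer holds because an
  unused name can be made constant at any given element of \<open>M\<close>. Nontriviality holds because an
  unused name can be required to be at least \<open>k\<close> at level \<open>k\<close>. The main point is Standard Part
  (\<open>standard_part_trace\<close>): the values at level \<open>k\<close> of a name for a set of natural numbers
  determine a binary tree, and its leftmost branch \<open>B\<close> is a set in \<open>M\<close>. Keeping at level \<open>k\<close> only
  the environments at which the name agrees with \<open>B\<close> below \<open>k\<close> gives a stronger condition, and
  that condition forces \<open>B\<close> to be the standard part of the name.

  Conditions are filter bases rather than infinite sets of indices so that this last step is a
  mere restriction of each level, instead of the extraction of a convergent subsequence.
  Soundness is proved for the forcing relation itself and not by way of generic filters;
  therefore \<open>M\<close> is arbitrary, of any cardinality and possibly ill-founded.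
\<close>

section \<open>Substitution and derivations\<close>

lemma subst_subst: "subst f (subst g \<phi>) = subst (\<lambda>x. f (g x)) \<phi>"
proof (induction \<phi> arbitrary: f g)
  case (Forall \<phi>)
  have "(\<lambda>x. case_nat 0 (\<lambda>x. Suc (f x)) (case_nat 0 (\<lambda>x. Suc (g x)) x))
      = case_nat 0 (\<lambda>x. Suc (f (g x)))"
    by (auto simp: fun_eq_iff split: nat.split)
  then show ?case by (simp add: Forall)
qed simp_all

lemma in_fm_subst [simp]: "in_fm (subst f \<phi>) = in_fm \<phi>"
  by (induction \<phi> arbitrary: f) simp_all

lemma in_fm_inst [simp]: "in_fm (inst t \<phi>) = in_fm \<phi>"
  by (simp add: inst_def)

lemma fv_below_mono: "fv_below m \<phi> \<Longrightarrow> m \<le> n \<Longrightarrow> fv_below n \<phi>"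
proof (induction \<phi> arbitrary: m n)
  case (Forall \<phi>)
  show ?case using Forall.IH[of "Suc m" "Suc n"] Forall.prems by simp
qed auto

lemma fv_below_ex: "\<exists>n. fv_below n \<phi>"
proof (induction \<phi>)
  case (Mem x y)
  show ?case by (rule exI[of _ "Suc (max x y)"]) auto
next
  case (Eq x y)
  show ?case by (rule exI[of _ "Suc (max x y)"]) auto
next
  case (Imp \<phi> \<psi>)
  then obtain m n where "fv_below m \<phi>" "fv_below n \<psi>" by blast
  then have "fv_below (max m n) (\<phi> \<^bold>\<longrightarrow> \<psi>)" by (auto intro: fv_below_mono)
  then show ?case ..
next
  case (Forall \<phi>)
  then show ?case by (meson fv_below.simps(6) fv_below_mono le_SucI order_refl)
qed auto

lemma fv_below_finite: "finite \<Delta> \<Longrightarrow> \<exists>n. \<forall>\<phi>\<in>\<Delta>. fv_below n \<phi>"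
proof (induction rule: finite_induct)
  case (insert \<phi> \<Delta>)
  then obtain n where n: "\<forall>\<phi>\<in>\<Delta>. fv_below n \<phi>" by blast
  obtain m where "fv_below m \<phi>" using fv_below_ex by blast
  then have "\<forall>\<psi>\<in>insert \<phi> \<Delta>. fv_below (max m n) \<psi>"
    using n by (auto intro: fv_below_mono)
  then show ?case ..
qed simp

lemma subst_cong:
  "fv_below n \<phi> \<Longrightarrow> (\<And>i. i < n \<Longrightarrow> f i = g i) \<Longrightarrow> subst f \<phi> = subst g \<phi>"
proof (induction \<phi> arbitrary: n f g)
  case (Forall \<phi>)
  show ?case
    using Forall.prems by (auto intro!: Forall.IH[of "Suc n"] split: nat.split)
next
  case (Imp \<phi> \<psi>)
  show ?case using Imp.prems Imp.IH(1)[of n f g] Imp.IH(2)[of n f g] by simp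
qed simp_all

lemma subst_id: "subst (\<lambda>x. x) \<phi> = \<phi>"
proof (induction \<phi>)
  case (Forall \<phi>)
  have "case_nat 0 Suc = (\<lambda>x. x)" by (auto simp: fun_eq_iff split: nat.split)
  then show ?case using Forall by simp
qed simp_all

lemma fv_below_subst:
  "fv_below n \<phi> \<Longrightarrow> (\<And>i. i < n \<Longrightarrow> f i < m) \<Longrightarrow> fv_below m (subst f \<phi>)"
proof (induction \<phi> arbitrary: n m f)
  case (Forall \<phi>)
  show ?case
    using Forall.prems by (auto intro!: Forall.IH[of "Suc n"] split: nat.split)
next
  case (Imp \<phi> \<psi>)
  show ?case using Imp.prems Imp.IH(1)[of n f m] Imp.IH(2)[of n f m] by simp
qed simp_all

lemma subst_inst: "subst f (inst t \<phi>) = inst (f t) (subst (case_nat 0 (\<lambda>x. Suc (f x))) \<phi>)"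
  unfolding inst_def subst_subst
  by (rule arg_cong[where f = "\<lambda>g. subst g \<phi>"]) (auto simp: fun_eq_iff split: nat.split)

lemma inst_subst_lift: "inst t (subst (case_nat 0 (\<lambda>x. Suc (v x))) \<phi>) = subst (case_nat t v) \<phi>"
  unfolding inst_def subst_subst
  by (rule arg_cong[where f = "\<lambda>g. subst g \<phi>"]) (auto simp: fun_eq_iff split: nat.split)

lemma derives_mono: "derives L \<Gamma> \<phi> \<Longrightarrow> \<Gamma> \<subseteq> \<Delta> \<Longrightarrow> derives L \<Delta> \<phi>"
proof (induction arbitrary: \<Delta> rule: derives.induct)
  case (ImpI \<phi> \<Gamma> \<psi>)
  then show ?case by (meson derives.ImpI insert_mono)
next
  case (Classical \<phi> \<Gamma>)
  then show ?case by (meson derives.Classical insert_mono)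
next
  case (ForallI \<Gamma> \<phi>)
  then show ?case by (meson derives.ForallI image_mono)
qed (blast intro: derives.intros)+

lemma derives_compact: "derives L \<Gamma> \<phi> \<Longrightarrow> \<exists>\<Delta>\<subseteq>\<Gamma>. finite \<Delta> \<and> derives L \<Delta> \<phi>"
proof (induction rule: derives.induct)
  case (Assm \<phi> \<Gamma>)
  then have "{\<phi>} \<subseteq> \<Gamma> \<and> finite {\<phi>} \<and> derives L {\<phi>} \<phi>" by (auto intro: derives.Assm)
  then show ?case by blast
next
  case (ImpI \<phi> \<Gamma> \<psi>)
  then obtain \<Delta> where "\<Delta> \<subseteq> insert \<phi> \<Gamma>" "finite \<Delta>" "derives L \<Delta> \<psi>" by blast
  then have "\<Delta> - {\<phi>} \<subseteq> \<Gamma>" "finite (\<Delta> - {\<phi>})" "derives L (\<Delta> - {\<phi>}) (\<phi> \<^bold>\<longrightarrow> \<psi>)"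
    using ImpI.hyps(1) by (auto intro!: derives.ImpI derives_mono[of L \<Delta> \<psi>])
  then show ?case by blast
next
  case (ImpE \<Gamma> \<phi> \<psi>)
  then obtain \<Delta>1 \<Delta>2 where "\<Delta>1 \<subseteq> \<Gamma>" "finite \<Delta>1" "derives L \<Delta>1 (\<phi> \<^bold>\<longrightarrow> \<psi>)"
    "\<Delta>2 \<subseteq> \<Gamma>" "finite \<Delta>2" "derives L \<Delta>2 \<phi>" by blast
  then have "\<Delta>1 \<union> \<Delta>2 \<subseteq> \<Gamma>" "finite (\<Delta>1 \<union> \<Delta>2)" "derives L (\<Delta>1 \<union> \<Delta>2) \<psi>"
    by (auto intro: derives.ImpE[OF derives_mono derives_mono])
  then show ?case by blast
next
  case (Classical \<phi> \<Gamma>)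
  then obtain \<Delta> where "\<Delta> \<subseteq> insert (\<^bold>\<not> \<phi>) \<Gamma>" "finite \<Delta>" "derives L \<Delta> \<^bold>\<bottom>" by blast
  then have "\<Delta> - {\<^bold>\<not> \<phi>} \<subseteq> \<Gamma>" "finite (\<Delta> - {\<^bold>\<not> \<phi>})" "derives L (\<Delta> - {\<^bold>\<not> \<phi>}) \<phi>"
    using Classical.hyps(1) by (auto intro!: derives.Classical derives_mono[of L \<Delta> "\<^bold>\<bottom>"])
  then show ?case by blast
next
  case (ForallI \<Gamma> \<phi>)
  then obtain \<Delta>' where "\<Delta>' \<subseteq> subst Suc ` \<Gamma>" "finite \<Delta>'" "derives L \<Delta>' \<phi>" by blast
  then obtain \<Delta> where "\<Delta> \<subseteq> \<Gamma>" "finite \<Delta>" "\<Delta>' = subst Suc ` \<Delta>"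
    by (meson finite_subset_image)
  then show ?case using \<open>derives L \<Delta>' \<phi>\<close> by (blast intro: derives.ForallI)
next
  case (EqRefl \<Gamma> x)
  have "derives L {} (x \<^bold>= x)" by (rule derives.EqRefl)
  then show ?case by blast
next
  case (EqSubst \<Gamma> x y \<phi>)
  then obtain \<Delta>1 \<Delta>2 where "\<Delta>1 \<subseteq> \<Gamma>" "finite \<Delta>1" "derives L \<Delta>1 (x \<^bold>= y)"
    "\<Delta>2 \<subseteq> \<Gamma>" "finite \<Delta>2" "derives L \<Delta>2 (inst x \<phi>)" by blast
  then have "\<Delta>1 \<union> \<Delta>2 \<subseteq> \<Gamma>" "finite (\<Delta>1 \<union> \<Delta>2)" "derives L (\<Delta>1 \<union> \<Delta>2) (inst y \<phi>)"
    by (auto intro: derives.EqSubst[OF derives_mono derives_mono])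
  then show ?case by blast
qed (blast intro: derives.intros)

lemma derives_subst:
  assumes "\<And>\<phi> f. \<phi> \<in> L \<Longrightarrow> subst f \<phi> \<in> L"
  shows "derives L \<Gamma> \<phi> \<Longrightarrow> derives L (subst f ` \<Gamma>) (subst f \<phi>)"
proof (induction arbitrary: f rule: derives.induct)
  case (ForallI \<Gamma> \<phi>)
  have "subst (case_nat 0 (\<lambda>x. Suc (f x))) ` subst Suc ` \<Gamma> = subst Suc ` subst f ` \<Gamma>"
    by (simp add: image_image subst_subst)
  then show ?case
    using ForallI.IH[of "case_nat 0 (\<lambda>x. Suc (f x))"] by (simp add: derives.ForallI)
next
  case (ForallE \<Gamma> \<phi> t)
  then show ?case by (auto simp: subst_inst intro: derives.ForallE)
next
  case (EqSubst \<Gamma> x y \<phi>)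
  then show ?case unfolding subst_inst by (auto intro: derives.EqSubst)
qed (use assms in \<open>auto intro: derives.intros\<close>)


section \<open>Completeness\<close>

instance fm :: countable
  by countable_datatype

lemma proves_in_subst: "\<Gamma> \<turnstile>\<^sub>\<in> \<phi> \<Longrightarrow> subst f ` \<Gamma> \<turnstile>\<^sub>\<in> subst f \<phi>"
  by (rule derives_subst) simp

text \<open>Renaming the fresh variable \<open>t\<close> to \<open>0\<close> turns a derivation of the instance at \<open>t\<close> into the
  premise of the rule \<open>ForallI\<close>.\<close>

lemma proves_in_generalize:
  assumes "\<Gamma> \<turnstile>\<^sub>\<in> inst t \<phi>" and fresh: "\<And>\<gamma>. \<gamma> \<in> \<Gamma> \<Longrightarrow> fv_below t \<gamma>" "fv_below t (Forall \<phi>)"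
  shows "\<Gamma> \<turnstile>\<^sub>\<in> Forall \<phi>"
proof -
  define f where "f i = (if i = t then 0 else Suc i)" for i
  have "subst f \<gamma> = subst Suc \<gamma>" if "\<gamma> \<in> \<Gamma>" for \<gamma>
    by (rule subst_cong[OF fresh(1)[OF that]]) (simp add: f_def)
  then have 1: "subst f ` \<Gamma> = subst Suc ` \<Gamma>" by simp
  have "subst f (inst t \<phi>) = subst (\<lambda>x. x) \<phi>"
    unfolding inst_def subst_subst using fresh(2)
    by (intro subst_cong[of "Suc t"]) (auto simp: f_def split: nat.split)
  with 1 proves_in_subst[OF assms(1), of f] show ?thesis
    by (simp add: derives.ForallI subst_id)
qed

lemma proves_in_inconsistent:
  assumes "in_fm \<phi>" "insert \<phi> \<Gamma> \<turnstile>\<^sub>\<in> \<^bold>\<bottom>" "insert (\<^bold>\<not> \<phi>) \<Gamma> \<turnstile>\<^sub>\<in> \<^bold>\<bottom>"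
  shows "\<Gamma> \<turnstile>\<^sub>\<in> \<^bold>\<bottom>"
proof (rule derives.ImpE)
  show "\<Gamma> \<turnstile>\<^sub>\<in> \<^bold>\<not> \<phi>" using assms by (auto intro: derives.ImpI)
  show "\<Gamma> \<turnstile>\<^sub>\<in> \<phi>" using assms by (auto intro: derives.Classical)
qed

text \<open>All axioms are sentences and only finitely many formulas have been added before, so some variable
  is still unused and can serve as the Henkin witness.\<close>

lemma henkin_step:
  assumes T: "\<And>\<gamma>. \<gamma> \<in> T \<Longrightarrow> sentence \<gamma>"
    and \<Delta>: "finite \<Delta>" "\<not> T \<union> \<Delta> \<turnstile>\<^sub>\<in> \<^bold>\<bottom>" and \<phi>: "in_fm \<phi>"
  shows "\<exists>\<Delta>'. finite \<Delta>' \<and> \<not> T \<union> \<Delta>' \<turnstile>\<^sub>\<in> \<^bold>\<bottom> \<and> \<Delta> \<subseteq> \<Delta>' \<and> (\<phi> \<in> \<Delta>' \<or> \<^bold>\<not> \<phi> \<in> \<Delta>') \<and>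
    (\<forall>\<psi>. \<phi> = Forall \<psi> \<longrightarrow> \<phi> \<in> \<Delta>' \<or> (\<exists>t. \<^bold>\<not> inst t \<psi> \<in> \<Delta>'))"
proof (cases "insert \<phi> (T \<union> \<Delta>) \<turnstile>\<^sub>\<in> \<^bold>\<bottom>")
  case False
  then show ?thesis using \<Delta> by (intro exI[of _ "insert \<phi> \<Delta>"]) auto
next
  case True
  with proves_in_inconsistent \<phi> \<Delta> have neg: "\<not> insert (\<^bold>\<not> \<phi>) (T \<union> \<Delta>) \<turnstile>\<^sub>\<in> \<^bold>\<bottom>" by blast
  show ?thesis
  proof (cases "\<exists>\<psi>. \<phi> = Forall \<psi>")
    case False
    then show ?thesis using neg \<Delta> by (intro exI[of _ "insert (\<^bold>\<not> \<phi>) \<Delta>"]) auto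
  next
    case True
    then obtain \<psi> where \<psi>: "\<phi> = Forall \<psi>" by blast
    obtain t where t: "\<forall>\<gamma>\<in>insert (\<^bold>\<not> \<phi>) \<Delta>. fv_below t \<gamma>"
      using fv_below_finite \<Delta> by (meson finite.insertI)
    let ?\<Gamma> = "insert (\<^bold>\<not> \<phi>) (T \<union> \<Delta>)"
    have fresh: "fv_below t \<gamma>" if "\<gamma> \<in> ?\<Gamma>" for \<gamma>
      using that t T by (auto simp: sentence_def intro: fv_below_mono)
    have "\<not> insert (\<^bold>\<not> inst t \<psi>) ?\<Gamma> \<turnstile>\<^sub>\<in> \<^bold>\<bottom>"
    proof
      assume "insert (\<^bold>\<not> inst t \<psi>) ?\<Gamma> \<turnstile>\<^sub>\<in> \<^bold>\<bottom>"
      then have "?\<Gamma> \<turnstile>\<^sub>\<in> inst t \<psi>" using \<phi> \<psi> by (auto intro: derives.Classical)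
      then have "?\<Gamma> \<turnstile>\<^sub>\<in> Forall \<psi>"
        by (rule proves_in_generalize) (use fresh t \<psi> in auto)
      moreover have "?\<Gamma> \<turnstile>\<^sub>\<in> \<^bold>\<not> \<phi>" using \<phi> by (intro derives.Assm) auto
      ultimately show False using neg \<psi> by (blast intro: derives.ImpE)
    qed
    then show ?thesis using \<Delta> \<psi>
      by (intro exI[of _ "insert (\<^bold>\<not> inst t \<psi>) (insert (\<^bold>\<not> \<phi>) \<Delta>)"]) (auto simp: insert_commute)
  qed
qed

lemma henkin_extension:
  assumes T: "\<And>\<gamma>. \<gamma> \<in> T \<Longrightarrow> sentence \<gamma>" and con: "\<not> T \<turnstile>\<^sub>\<in> \<^bold>\<bottom>"
  obtains H where "T \<subseteq> H" "\<not> H \<turnstile>\<^sub>\<in> \<^bold>\<bottom>" "\<And>\<phi>. in_fm \<phi> \<Longrightarrow> \<phi> \<in> H \<or> \<^bold>\<not> \<phi> \<in> H"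
    "\<And>\<psi>. in_fm \<psi> \<Longrightarrow> Forall \<psi> \<in> H \<or> (\<exists>t. \<^bold>\<not> inst t \<psi> \<in> H)"
proof -
  define P where "P n \<Delta> \<longleftrightarrow> finite \<Delta> \<and> \<not> T \<union> \<Delta> \<turnstile>\<^sub>\<in> \<^bold>\<bottom>" for n :: nat and \<Delta>
  define Q where "Q n \<Delta> \<Delta>' \<longleftrightarrow> \<Delta> \<subseteq> \<Delta>' \<and> (let \<phi> = from_nat n in in_fm \<phi> \<longrightarrow>
    (\<phi> \<in> \<Delta>' \<or> \<^bold>\<not> \<phi> \<in> \<Delta>') \<and> (\<forall>\<psi>. \<phi> = Forall \<psi> \<longrightarrow> \<phi> \<in> \<Delta>' \<or> (\<exists>t. \<^bold>\<not> inst t \<psi> \<in> \<Delta>')))"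
    for n :: nat and \<Delta> \<Delta>'
  have "\<exists>D. \<forall>n. P n (D n) \<and> Q n (D n) (D (Suc n))"
  proof (rule dependent_nat_choice)
    show "\<exists>\<Delta>. P 0 \<Delta>" using con by (auto simp: P_def intro!: exI[of _ "{}"])
  next
    fix \<Delta> n assume "P n \<Delta>"
    then have *: "finite \<Delta>" "\<not> T \<union> \<Delta> \<turnstile>\<^sub>\<in> \<^bold>\<bottom>" by (auto simp: P_def)
    show "\<exists>\<Delta>'. P (Suc n) \<Delta>' \<and> Q n \<Delta> \<Delta>'"
    proof (cases "in_fm (from_nat n)")
      case True
      from henkin_step[OF T * True] show ?thesis by (simp add: P_def Q_def Let_def) blast
    next
      case False
      then show ?thesis using * by (auto simp: P_def Q_def Let_def)
    qed
  qed
  then obtain D where D: "\<And>n. P n (D n)" "\<And>n. Q n (D n) (D (Suc n))" by blast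
  define H where "H = T \<union> (\<Union>n. D n)"
  have "D n \<subseteq> D (Suc n)" for n using D(2) by (auto simp: Q_def)
  then have mono: "D m \<subseteq> D n" if "m \<le> n" for m n using that lift_Suc_mono_le by blast
  have fin: "\<exists>n. \<Delta> \<subseteq> T \<union> D n" if "finite \<Delta>" "\<Delta> \<subseteq> H" for \<Delta>
    using that
  proof (induction rule: finite_induct)
    case (insert \<phi> \<Delta>)
    then obtain n where n: "\<Delta> \<subseteq> T \<union> D n" by auto
    obtain m where m: "\<phi> \<in> T \<union> D m" using insert.prems by (auto simp: H_def)
    have "D n \<subseteq> D (max m n)" "D m \<subseteq> D (max m n)" by (auto intro!: mono)
    then have "insert \<phi> \<Delta> \<subseteq> T \<union> D (max m n)" using m n by blast
    then show ?case by blast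
  qed simp
  have "\<not> H \<turnstile>\<^sub>\<in> \<^bold>\<bottom>"
  proof
    assume "H \<turnstile>\<^sub>\<in> \<^bold>\<bottom>"
    from derives_compact[OF this]
    obtain \<Delta> where \<Delta>: "\<Delta> \<subseteq> H" "finite \<Delta>" "\<Delta> \<turnstile>\<^sub>\<in> \<^bold>\<bottom>" by blast
    obtain n where "\<Delta> \<subseteq> T \<union> D n" using fin[OF \<Delta>(2,1)] by blast
    with \<Delta>(3) have "T \<union> D n \<turnstile>\<^sub>\<in> \<^bold>\<bottom>" by (rule derives_mono)
    then show False using D(1) by (auto simp: P_def)
  qed
  moreover have "\<phi> \<in> H \<or> \<^bold>\<not> \<phi> \<in> H" if "in_fm \<phi>" for \<phi>
    using D(2)[of "to_nat \<phi>"] that by (auto simp: Q_def Let_def H_def)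
  moreover have "Forall \<psi> \<in> H \<or> (\<exists>t. \<^bold>\<not> inst t \<psi> \<in> H)" if "in_fm \<psi>" for \<psi>
    using D(2)[of "to_nat (Forall \<psi>)"] that by (auto simp: Q_def Let_def H_def)
  ultimately show thesis using that[of H] by (auto simp: H_def)
qed

text \<open>The variables, as elements of the term model, are identified only up to provable equality;
  \<open>satR\<close> is \<open>sat\<close> with equality read as the relation \<open>R\<close>.\<close>

primrec satR :: "('a \<Rightarrow> 'a \<Rightarrow> bool) \<Rightarrow> ('a \<Rightarrow> 'a \<Rightarrow> bool) \<Rightarrow> (nat \<Rightarrow> 'a) \<Rightarrow> fm \<Rightarrow> bool" where
  "satR E R e (x \<^bold>\<in> y) = E (e x) (e y)"
| "satR E R e (x \<^bold>= y) = R (e x) (e y)"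
| "satR E R e (St x) = False"
| "satR E R e \<^bold>\<bottom> = False"
| "satR E R e (\<phi> \<^bold>\<longrightarrow> \<psi>) = (satR E R e \<phi> \<longrightarrow> satR E R e \<psi>)"
| "satR E R e (Forall \<phi>) = (\<forall>a. satR E R (case_nat a e) \<phi>)"

lemma term_model:
  assumes T: "\<And>\<gamma>. \<gamma> \<in> T \<Longrightarrow> in_fm \<gamma> \<and> sentence \<gamma>" and con: "\<not> T \<turnstile>\<^sub>\<in> \<^bold>\<bottom>"
  obtains E R :: "nat \<Rightarrow> nat \<Rightarrow> bool" where "equivp R"
    "\<And>x y x' y'. R x x' \<Longrightarrow> R y y' \<Longrightarrow> E x y \<Longrightarrow> E x' y'"
    "\<And>\<gamma> e. \<gamma> \<in> T \<Longrightarrow> satR E R e \<gamma>"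
proof -
  obtain H where H: "T \<subseteq> H" "\<not> H \<turnstile>\<^sub>\<in> \<^bold>\<bottom>" "\<And>\<phi>. in_fm \<phi> \<Longrightarrow> \<phi> \<in> H \<or> \<^bold>\<not> \<phi> \<in> H"
    "\<And>\<psi>. in_fm \<psi> \<Longrightarrow> Forall \<psi> \<in> H \<or> (\<exists>t. \<^bold>\<not> inst t \<psi> \<in> H)"
    using henkin_extension[of T] T con by metis
  have assm: "H \<turnstile>\<^sub>\<in> \<phi>" if "\<phi> \<in> H" "in_fm \<phi>" for \<phi> using that by (auto intro: derives.Assm)
  have contra: False if "H \<turnstile>\<^sub>\<in> \<phi>" "\<^bold>\<not> \<phi> \<in> H" "in_fm \<phi>" for \<phi>
    using that assm[of "\<^bold>\<not> \<phi>"] H(2) by (auto intro: derives.ImpE)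
  have closed: "\<phi> \<in> H \<longleftrightarrow> H \<turnstile>\<^sub>\<in> \<phi>" if "in_fm \<phi>" for \<phi>
    using assm contra H(3) that by blast
  define E where "E x y \<longleftrightarrow> (x \<^bold>\<in> y) \<in> H" for x y
  define R where "R x y \<longleftrightarrow> (x \<^bold>= y) \<in> H" for x y
  have R: "R x y \<longleftrightarrow> H \<turnstile>\<^sub>\<in> x \<^bold>= y" and E: "E x y \<longleftrightarrow> H \<turnstile>\<^sub>\<in> x \<^bold>\<in> y" for x y
    using closed by (auto simp: R_def E_def)
  have refl: "R x x" for x unfolding R by (rule derives.EqRefl)
  have repl: "H \<turnstile>\<^sub>\<in> subst (case_nat y (\<lambda>x. x)) \<phi>"
    if "R x y" "H \<turnstile>\<^sub>\<in> subst (case_nat x (\<lambda>x. x)) \<phi>" for x y \<phi>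
    using derives.EqSubst[of _ H x y \<phi>] that by (simp add: R inst_def)
  have sym: "R y x" if "R x y" for x y
    using repl[OF that, of "0 \<^bold>= Suc x"] refl[of x] by (simp add: R)
  have trans: "R x z" if "R x y" "R y z" for x y z
    using repl[OF that(2), of "Suc x \<^bold>= 0"] that by (simp add: R)
  have "equivp R" by (rule equivpI) (auto intro!: reflpI sympI transpI intro: refl sym trans)
  moreover have "E x' y'" if "R x x'" "R y y'" "E x y" for x y x' y'
    using repl[OF that(1), of "0 \<^bold>\<in> Suc y"] repl[OF that(2), of "Suc x' \<^bold>\<in> 0"] that by (simp add: E)
  moreover have truth: "satR E R v \<phi> \<longleftrightarrow> subst v \<phi> \<in> H" if "in_fm \<phi>" for v \<phi>
    using that
  proof (induction \<phi> arbitrary: v)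
    case Fls
    then show ?case using closed[of "\<^bold>\<bottom>"] H(2) by simp
  next
    case (Imp \<phi> \<psi>)
    have "(subst v \<phi> \<in> H \<longrightarrow> subst v \<psi> \<in> H) \<longleftrightarrow> (subst v \<phi> \<^bold>\<longrightarrow> subst v \<psi>) \<in> H"
    proof
      assume *: "subst v \<phi> \<in> H \<longrightarrow> subst v \<psi> \<in> H"
      have "insert (subst v \<phi>) H \<turnstile>\<^sub>\<in> subst v \<psi>"
      proof (cases "subst v \<phi> \<in> H")
        case True
        then show ?thesis using * Imp.prems by (auto intro!: derives.Assm)
      next
        case False
        then have "\<^bold>\<not> subst v \<phi> \<in> H" using H(3)[of "subst v \<phi>"] Imp.prems by auto
        then have "insert (subst v \<phi>) H \<turnstile>\<^sub>\<in> \<^bold>\<not> subst v \<phi>"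
          using Imp.prems by (auto intro: derives.Assm)
        moreover have "insert (subst v \<phi>) H \<turnstile>\<^sub>\<in> subst v \<phi>"
          using Imp.prems by (auto intro: derives.Assm)
        ultimately have "insert (subst v \<phi>) H \<turnstile>\<^sub>\<in> \<^bold>\<bottom>" by (rule derives.ImpE)
        then have "insert (\<^bold>\<not> subst v \<psi>) (insert (subst v \<phi>) H) \<turnstile>\<^sub>\<in> \<^bold>\<bottom>"
          by (rule derives_mono) blast
        then show ?thesis using Imp.prems by (auto intro: derives.Classical)
      qed
      then show "(subst v \<phi> \<^bold>\<longrightarrow> subst v \<psi>) \<in> H"
        using Imp.prems by (subst closed) (auto intro: derives.ImpI)
    next
      assume "(subst v \<phi> \<^bold>\<longrightarrow> subst v \<psi>) \<in> H"
      then show "subst v \<phi> \<in> H \<longrightarrow> subst v \<psi> \<in> H"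
        using Imp.prems closed by (auto intro: derives.ImpE)
    qed
    then show ?case using Imp by simp
  next
    case (Forall \<phi>)
    let ?\<psi> = "subst (case_nat 0 (\<lambda>x. Suc (v x))) \<phi>"
    have in': "in_fm ?\<psi>" using Forall.prems by simp
    have "Forall ?\<psi> \<in> H \<longleftrightarrow> (\<forall>t. inst t ?\<psi> \<in> H)"
    proof
      assume "Forall ?\<psi> \<in> H"
      then show "\<forall>t. inst t ?\<psi> \<in> H" using in' closed by (simp add: derives.ForallE)
    next
      assume *: "\<forall>t. inst t ?\<psi> \<in> H"
      show "Forall ?\<psi> \<in> H"
      proof (rule ccontr)
        assume "Forall ?\<psi> \<notin> H"
        then obtain t where "\<^bold>\<not> inst t ?\<psi> \<in> H" using H(4)[OF in'] by blast
        then show False using contra[of "inst t ?\<psi>"] * in' closed by simp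
      qed
    qed
    then show ?case using Forall by (simp add: inst_subst_lift)
  qed (simp_all add: E_def R_def)
  moreover have "satR E R e \<gamma>" if "\<gamma> \<in> T" for \<gamma> e
  proof -
    have "subst e \<gamma> = subst (\<lambda>x. x) \<gamma>"
      using T[OF that] by (intro subst_cong[of 0]) (auto simp: sentence_def)
    then have "subst e \<gamma> = \<gamma>" by (simp add: subst_id)
    then show ?thesis using truth T[OF that] H(1) that by auto
  qed
  ultimately show thesis using that[of R E] by blast
qed

text \<open>\<open>h\<close> picks one representative from every class of \<open>R\<close>; reindexing along \<open>h\<close> turns \<open>R\<close> into true
  equality.\<close>

lemma sat_factor:
  assumes cong: "\<And>x y x' y'. R x x' \<Longrightarrow> R y y' \<Longrightarrow> E x y \<Longrightarrow> E x' y'" and "equivp R"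
    and h: "\<And>a b. R (h a) (h b) \<longleftrightarrow> a = b" "\<And>x. \<exists>a. R x (h a)"
    and \<phi>: "in_fm \<phi>" and ev: "\<And>i. R (v i) (h (e i))"
  shows "sat (\<lambda>a b. E (h a) (h b)) S e \<phi> \<longleftrightarrow> satR E R v \<phi>"
  using \<phi> ev
proof (induction \<phi> arbitrary: e v)
  case (Mem x y)
  then show ?case using cong equivp_symp[OF \<open>equivp R\<close>] by (simp, blast)
next
  case (Eq x y)
  have "R (v x) (v y) \<longleftrightarrow> R (h (e x)) (h (e y))"
    using Eq.prems(2) \<open>equivp R\<close> by (meson equivp_symp equivp_transp)
  then show ?case using h(1) by simp
next
  case (Imp \<phi> \<psi>)
  have "sat (\<lambda>a b. E (h a) (h b)) S e \<phi> \<longleftrightarrow> satR E R v \<phi>"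
    "sat (\<lambda>a b. E (h a) (h b)) S e \<psi> \<longleftrightarrow> satR E R v \<psi>"
    by (rule Imp.IH; use Imp.prems in simp)+
  then show ?case by simp
next
  case (Forall \<phi>)
  have *: "sat (\<lambda>a b. E (h a) (h b)) S (case_nat a e) \<phi> \<longleftrightarrow> satR E R (case_nat x v) \<phi>"
    if "R x (h a)" for a x
    using Forall.prems that by (intro Forall.IH) (auto split: nat.split)
  show ?case using * h(2) equivp_reflp[OF \<open>equivp R\<close>] by (simp, blast)
qed simp_all

text \<open>An infinite term model can be transported to the type of natural numbers. It is infinite because
  finitely many elements always lie in a common set, while no set contains everything.\<close>

lemma term_model_infinite:
  assumes cong: "\<And>x y x' y'. R x x' \<Longrightarrow> R y y' \<Longrightarrow> E x y \<Longrightarrow> E x' y'" and "equivp R"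
    and ax: "satR E R e Pairing" "satR E R e Union_Set" "satR E R e Foundation"
    and rep: "\<And>x. \<exists>y\<in>D. R x y"
  shows "infinite D"
proof
  assume "finite D"
  have pair: "\<exists>p. \<forall>z. E z p \<longleftrightarrow> R z x \<or> R z y" for x y
    using ax(1) by (simp only: Pairing_def satR.simps connectives, simp add: case_nat_numeral)
  have union: "\<exists>u. \<forall>z. E z u \<longleftrightarrow> (\<exists>y. E y x \<and> E z y)" for x
    using ax(2) by (simp only: Union_Set_def satR.simps connectives, simp add: case_nat_numeral)
  have fnd: "E y x \<Longrightarrow> \<exists>y. E y x \<and> (\<forall>z. E z x \<longrightarrow> \<not> E z y)" for x y
    using ax(3) by (simp only: Foundation_def satR.simps connectives, simp add: case_nat_numeral, blast)
  have refl: "R x x" for x by (rule equivp_reflp[OF \<open>equivp R\<close>])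
  have "\<exists>u. \<forall>z\<in>D. E z u"
    using \<open>finite D\<close>
  proof (induction rule: finite_induct)
    case (insert a F)
    then obtain u where u: "\<forall>z\<in>F. E z u" by blast
    obtain p where p: "\<forall>z. E z p \<longleftrightarrow> R z a \<or> R z a" using pair by blast
    obtain q where q: "\<forall>z. E z q \<longleftrightarrow> R z u \<or> R z p" using pair by blast
    obtain w where w: "\<forall>z. E z w \<longleftrightarrow> (\<exists>y. E y q \<and> E z y)" using union by blast
    from u p q w have "\<forall>z\<in>insert a F. E z w" using refl by blast
    then show ?case ..
  qed simp
  then obtain u where "E z u" for z
    using rep cong refl equivp_symp[OF \<open>equivp R\<close>] by metis
  then have uu: "E u u" by blast
  obtain p where p: "\<forall>z. E z p \<longleftrightarrow> R z u \<or> R z u" using pair by blast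
  then obtain y where "R y u" "\<not> E u y" using fnd[of u p] refl by blast
  then show False using uu cong refl equivp_symp[OF \<open>equivp R\<close>] by metis
qed

lemma fv_below_Foralls: "fv_below m ((Forall ^^ n) \<phi>) \<longleftrightarrow> fv_below (m + n) \<phi>"
  by (induction n arbitrary: m) simp_all

lemma in_fm_Foralls: "in_fm ((Forall ^^ n) \<phi>) \<longleftrightarrow> in_fm \<phi>"
  by (induction n) simp_all

lemma ZF_in_sentence:
  assumes "\<gamma> \<in> ZF"
  shows "in_fm \<gamma> \<and> sentence \<gamma>"
proof -
  have sep: "in_fm (separation_fm \<phi>) \<and> fv_below n (separation_fm \<phi>)"
    if "in_fm \<phi>" "fv_below (n + 1) \<phi>" for n \<phi>
    using that unfolding separation_fm_def
    by (auto intro!: fv_below_subst[of "n + 1"] split: nat.split)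
  have repl: "in_fm (replacement_fm \<phi>) \<and> fv_below n (replacement_fm \<phi>)"
    if "in_fm \<phi>" "fv_below (n + 2) \<phi>" for n \<phi>
    using that unfolding replacement_fm_def
    by (auto intro!: fv_below_subst[of "n + 2"] split: nat.split)
  show ?thesis
    using assms sep repl
    unfolding ZF_def Separation_def Replacement_def
    by (auto simp: sentence_def fv_below_Foralls in_fm_Foralls)
      (simp_all add: Extensionality_def Foundation_def Pairing_def Union_Set_def Power_Set_def
        Infinity_def inductive_fm_def subset_fm_def empty_fm_def succ_fm_def)
qed

text \<open>The model is taken on the type \<open>nat\<close>, since a quotient of the set of variables by an equality that
  depends on \<open>\<theta>\<close> is not a type. The least elements of the classes form an infinite set of natural
  numbers, and its enumeration is the required reindexing.\<close>

theorem ZF_completeness: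
  assumes \<theta>: "in_fm \<theta>" "sentence \<theta>"
    and valid: "\<And>E :: nat \<Rightarrow> nat \<Rightarrow> bool. (\<And>\<gamma> e. \<gamma> \<in> ZF \<Longrightarrow> sat E (\<lambda>_. False) e \<gamma>) \<Longrightarrow>
      sat E (\<lambda>_. False) (\<lambda>_. 0) \<theta>"
  shows "ZF \<turnstile>\<^sub>\<in> \<theta>"
proof (rule ccontr)
  assume "\<not> ZF \<turnstile>\<^sub>\<in> \<theta>"
  then have con: "\<not> insert (\<^bold>\<not> \<theta>) ZF \<turnstile>\<^sub>\<in> \<^bold>\<bottom>" using \<theta> by (blast intro: derives.Classical)
  have T: "in_fm \<gamma> \<and> sentence \<gamma>" if "\<gamma> \<in> insert (\<^bold>\<not> \<theta>) ZF" for \<gamma>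
    using that ZF_in_sentence \<theta> by (auto simp: sentence_def)
  obtain E R :: "nat \<Rightarrow> nat \<Rightarrow> bool" where R: "equivp R"
    and cong: "\<And>x y x' y'. R x x' \<Longrightarrow> R y y' \<Longrightarrow> E x y \<Longrightarrow> E x' y'"
    and mod: "\<And>\<gamma> e. \<gamma> \<in> insert (\<^bold>\<not> \<theta>) ZF \<Longrightarrow> satR E R e \<gamma>"
    using term_model[OF T con] by metis
  define rep where "rep x = (LEAST y. R x y)" for x
  have R_rep: "R x (rep x)" for x
    unfolding rep_def by (rule LeastI[of _ x]) (rule equivp_reflp[OF R])
  have rep_eq: "rep x = rep y" if "R x y" for x y
  proof -
    have "R x = R y" using that R by (metis equivp_def)
    then show ?thesis by (simp add: rep_def)
  qed
  have rep_rep: "rep (rep x) = rep x" for x using rep_eq R_rep by metis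
  have inf: "infinite (range rep)"
    using cong R
  proof (rule term_model_infinite)
    show "satR E R (\<lambda>_. 0) Pairing" "satR E R (\<lambda>_. 0) Union_Set" "satR E R (\<lambda>_. 0) Foundation"
      by (auto intro!: mod simp: ZF_def)
    show "\<exists>y\<in>range rep. R x y" for x using R_rep by blast
  qed
  then have bij: "bij_betw (enumerate (range rep)) UNIV (range rep)" by (rule bij_enumerate)
  let ?h = "enumerate (range rep)"
  have h1: "R (?h a) (?h b) \<longleftrightarrow> a = b" for a b
  proof
    assume "R (?h a) (?h b)"
    moreover have "rep (?h i) = ?h i" for i using bij_betwE[OF bij] rep_rep by (metis UNIV_I rangeE)
    ultimately have "?h a = ?h b" using rep_eq by metis
    then show "a = b" using bij by (simp add: bij_betw_def inj_eq)
  qed (use equivp_reflp[OF R] in simp)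
  have h2: "\<exists>a. R x (?h a)" for x
    using bij R_rep[of x] by (metis bij_betw_def imageE rangeI)
  have fact: "sat (\<lambda>a b. E (?h a) (?h b)) (\<lambda>_. False) e \<phi> \<longleftrightarrow> satR E R (\<lambda>i. ?h (e i)) \<phi>"
    if "in_fm \<phi>" for e \<phi>
    using cong R h1 h2 that equivp_reflp[OF R] by (rule sat_factor)
  have "sat (\<lambda>a b. E (?h a) (?h b)) (\<lambda>_. False) (\<lambda>_. 0) \<theta>"
    by (rule valid) (simp add: fact T mod)
  moreover have "\<not> satR E R e \<theta>" for e using mod[of "\<^bold>\<not> \<theta>" e] by simp
  ultimately show False using fact[OF \<theta>(1)] by blast
qed

section \<open>Definable predicates in a model of ZF\<close>

lemma sat_cong:
  "fv_below n \<phi> \<Longrightarrow> (\<And>i. i < n \<Longrightarrow> e i = e' i) \<Longrightarrow> sat E S e \<phi> = sat E S e' \<phi>"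
proof (induction \<phi> arbitrary: n e e')
  case (Imp \<phi> \<psi>)
  show ?case using Imp.prems Imp.IH(1)[of n e e'] Imp.IH(2)[of n e e'] by simp
next
  case (Forall \<phi>)
  have "sat E S (case_nat a e) \<phi> = sat E S (case_nat a e') \<phi>" for a
    using Forall.prems by (intro Forall.IH[of "Suc n"]) (auto split: nat.split)
  then show ?case by simp
qed simp_all

lemma sat_Foralls:
  assumes "\<And>e. sat E S e ((Forall ^^ n) \<phi>)"
  shows "sat E S e \<phi>"
  using assms
proof (induction n arbitrary: e)
  case (Suc n)
  have "sat E S e' ((Forall ^^ n) \<phi>)" for e'
  proof -
    have "sat E S (case_nat (e' 0) (\<lambda>i. e' (Suc i))) ((Forall ^^ n) \<phi>)"
      using Suc.prems[of "\<lambda>i. e' (Suc i)"] by simp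
    moreover have "case_nat (e' 0) (\<lambda>i. e' (Suc i)) = e'"
      by (auto simp: fun_eq_iff split: nat.split)
    ultimately show ?thesis by simp
  qed
  then show ?case by (rule Suc.IH)
qed simp

locale zf_model =
  fixes E :: "'a \<Rightarrow> 'a \<Rightarrow> bool"
  assumes ZF: "\<gamma> \<in> ZF \<Longrightarrow> sat E (\<lambda>_. False) e \<gamma>"
begin

abbreviation holds :: "(nat \<Rightarrow> 'a) \<Rightarrow> fm \<Rightarrow> bool" where
  "holds \<equiv> sat E (\<lambda>_. False)"

text \<open>Definability with parameters, for predicates of environments. Each variable of the defining
  formula stands for a parameter (\<open>Inl\<close>) or for a coordinate of the environment (\<open>Inr\<close>).\<close>

definition definable :: "((nat \<Rightarrow> 'a) \<Rightarrow> bool) \<Rightarrow> bool" where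
  "definable P \<longleftrightarrow> (\<exists>\<phi> f. in_fm \<phi> \<and> (\<forall>e. P e \<longleftrightarrow> holds (\<lambda>j. case f j of Inl a \<Rightarrow> a | Inr i \<Rightarrow> e i) \<phi>))"

text \<open>Coordinates and constants are the possible arguments of an atomic predicate. With them the
  definability of a predicate follows from its syntactic shape by the introduction rules
  collected in \<open>definable_intros\<close>.\<close>

definition coord :: "((nat \<Rightarrow> 'a) \<Rightarrow> 'a) \<Rightarrow> bool" where
  "coord t \<longleftrightarrow> (\<exists>s. t = (\<lambda>e. case s of Inl a \<Rightarrow> a | Inr i \<Rightarrow> e i))"

lemma coord_var: "coord (\<lambda>e. e i)"
  unfolding coord_def by (rule exI[of _ "Inr i"]) simp

lemma coord_par: "coord (\<lambda>e. a)"
  unfolding coord_def by (rule exI[of _ "Inl a"]) simp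

lemma definableI: "in_fm \<phi> \<Longrightarrow> (\<And>e. P e \<longleftrightarrow> holds (\<lambda>j. case f j of Inl a \<Rightarrow> a | Inr i \<Rightarrow> e i) \<phi>) \<Longrightarrow> definable P"
  unfolding definable_def by blast

lemma definable_subst:
  assumes "definable P" "\<And>i. coord (t i)"
  shows "definable (\<lambda>e. P (\<lambda>i. t i e))"
proof -
  obtain \<phi> f where \<phi>: "in_fm \<phi>"
    and P: "\<And>e. P e \<longleftrightarrow> holds (\<lambda>j. case f j of Inl a \<Rightarrow> a | Inr i \<Rightarrow> e i) \<phi>"
    using assms(1) unfolding definable_def by blast
  obtain s where s: "\<And>i. t i = (\<lambda>e. case s i of Inl a \<Rightarrow> a | Inr i \<Rightarrow> e i)"
    using assms(2) unfolding coord_def by metis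
  have "(\<lambda>j. case f j of Inl a \<Rightarrow> a | Inr i \<Rightarrow> t i e) =
      (\<lambda>j. case (case f j of Inl a \<Rightarrow> Inl a | Inr i \<Rightarrow> s i) of Inl a \<Rightarrow> a | Inr i \<Rightarrow> e i)" for e
    by (auto simp: fun_eq_iff s split: sum.split)
  with \<phi> P show ?thesis
    by (intro definableI[of \<phi> _ "\<lambda>j. case f j of Inl a \<Rightarrow> Inl a | Inr i \<Rightarrow> s i"]) simp_all
qed

lemma definable_holds:
  assumes "in_fm \<phi>" "\<And>i. coord (t i)"
  shows "definable (\<lambda>e. holds (\<lambda>i. t i e) \<phi>)"
proof -
  have "definable (\<lambda>e. holds e \<phi>)" using assms(1) by (rule definableI[of \<phi> _ Inr]) simp
  from definable_subst[OF this, of t] assms(2) show ?thesis by simp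
qed

lemma definable_E:
  assumes "coord t" "coord u" shows "definable (\<lambda>e. E (t e) (u e))"
  using definable_holds[of "0 \<^bold>\<in> 1" "\<lambda>i. if i = 0 then t else u"] assms by simp

lemma definable_eq:
  assumes "coord t" "coord u" shows "definable (\<lambda>e. t e = u e)"
  using definable_holds[of "0 \<^bold>= 1" "\<lambda>i. if i = 0 then t else u"] assms by simp

lemma definable_False: "definable (\<lambda>e. False)"
  using definable_holds[of "\<^bold>\<bottom>" "\<lambda>i e. e i"] coord_var by simp

lemma definable_imp:
  assumes "definable P" "definable Q"
  shows "definable (\<lambda>e. P e \<longrightarrow> Q e)"
proof -
  obtain \<phi> f where \<phi>: "in_fm \<phi>"
    and P: "\<And>e. P e \<longleftrightarrow> holds (\<lambda>j. case f j of Inl a \<Rightarrow> a | Inr i \<Rightarrow> e i) \<phi>"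
    using assms(1) unfolding definable_def by blast
  obtain \<psi> g where \<psi>: "in_fm \<psi>"
    and Q: "\<And>e. Q e \<longleftrightarrow> holds (\<lambda>j. case g j of Inl a \<Rightarrow> a | Inr i \<Rightarrow> e i) \<psi>"
    using assms(2) unfolding definable_def by blast
  show ?thesis
    \<comment> \<open>The two formulas get disjoint sets of variables, the even and the odd ones.\<close>
    by (rule definableI[of "subst (\<lambda>j. 2 * j) \<phi> \<^bold>\<longrightarrow> subst (\<lambda>j. 2 * j + 1) \<psi>" _
          "\<lambda>j. if even j then f (j div 2) else g (j div 2)"])
      (use \<phi> \<psi> in \<open>simp_all add: P Q sat_subst in_fm_subst\<close>)
qed

lemma definable_all:
  assumes "definable (\<lambda>e. P (e 0) (\<lambda>i. e (Suc i)))"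
  shows "definable (\<lambda>e. \<forall>a. P a e)"
proof -
  obtain \<phi> f where \<phi>: "in_fm \<phi>"
    and P: "\<And>e. P (e 0) (\<lambda>i. e (Suc i)) \<longleftrightarrow> holds (\<lambda>j. case f j of Inl a \<Rightarrow> a | Inr i \<Rightarrow> e i) \<phi>"
    using assms unfolding definable_def by blast
  have P': "P a e \<longleftrightarrow> holds (\<lambda>j. case f j of Inl b \<Rightarrow> b | Inr i \<Rightarrow> case_nat a e i) \<phi>" for a e
    using P[of "case_nat a e"] by simp
  have eq: "(\<lambda>j. case_nat a (\<lambda>j. case (case f j of Inl a \<Rightarrow> Inl a | Inr i \<Rightarrow> Inr (i - 1)) of
        Inl a \<Rightarrow> a | Inr i \<Rightarrow> e i) (if f j = Inr 0 then 0 else Suc j)) =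
      (\<lambda>j. case f j of Inl b \<Rightarrow> b | Inr i \<Rightarrow> case_nat a e i)" for a and e :: "nat \<Rightarrow> 'a"
    by (auto simp: fun_eq_iff split: sum.split nat.split)
  show ?thesis
    by (rule definableI[of "Forall (subst (\<lambda>j. if f j = Inr 0 then 0 else Suc j) \<phi>)" _
          "\<lambda>j. case f j of Inl a \<Rightarrow> Inl a | Inr i \<Rightarrow> Inr (i - 1)"])
      (use \<phi> in \<open>simp_all only: P' sat_subst in_fm_subst in_fm.simps sat.simps eq\<close>)
qed

lemma definable_not: "definable P \<Longrightarrow> definable (\<lambda>e. \<not> P e)"
  using definable_imp[OF _ definable_False] by simp

lemma definable_conj: "definable P \<Longrightarrow> definable Q \<Longrightarrow> definable (\<lambda>e. P e \<and> Q e)"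
  using definable_not[OF definable_imp[OF _ definable_not, of P Q]] by simp

lemma definable_disj: "definable P \<Longrightarrow> definable Q \<Longrightarrow> definable (\<lambda>e. P e \<or> Q e)"
  using definable_imp[OF definable_not, of P Q] by (simp add: disj_imp)

lemma definable_iff: "definable P \<Longrightarrow> definable Q \<Longrightarrow> definable (\<lambda>e. P e \<longleftrightarrow> Q e)"
  unfolding iff_conv_conj_imp by (intro definable_conj definable_imp)

lemma definable_ex:
  assumes "definable (\<lambda>e. P (e 0) (\<lambda>i. e (Suc i)))"
  shows "definable (\<lambda>e. \<exists>a. P a e)"
  using definable_not[OF definable_all[OF definable_not[OF assms]]] by simp

lemma in_fm_nat_fm: "in_fm (nat_fm x)"
  by (simp add: nat_fm_def inductive_fm_def empty_fm_def succ_fm_def)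

lemma definable_nat: "coord t \<Longrightarrow> definable (\<lambda>e. is_nat E (t e))"
  using definable_holds[OF in_fm_nat_fm, of "\<lambda>i. t" 0] by (simp only: sat_nat_fm)

lemmas definable_intros =
  definable_E definable_eq definable_False definable_not definable_imp definable_conj definable_disj definable_iff definable_all definable_ex definable_nat
  coord_var coord_par

text \<open>Together with \<open>definable_projection\<close> this makes quantification over whole environments
  first-order; it also supplies unused names.\<close>

lemma definable_support:
  assumes "definable P"
  obtains N where "\<And>e e'. (\<And>i. i < N \<Longrightarrow> e i = e' i) \<Longrightarrow> P e \<longleftrightarrow> P e'"
proof -
  obtain \<phi> f where P: "\<And>e. P e \<longleftrightarrow> holds (\<lambda>j. case f j of Inl a \<Rightarrow> a | Inr i \<Rightarrow> e i) \<phi>"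
    using assms unfolding definable_def by blast
  obtain n where n: "fv_below n \<phi>" using fv_below_ex by blast
  have "finite (Inr -` f ` {..<n})" by (intro finite_vimageI) auto
  then obtain N where N: "\<And>i. Inr i \<in> f ` {..<n} \<Longrightarrow> i < N"
    unfolding finite_nat_set_iff_bounded by auto
  show thesis
  proof (rule that[of N])
    fix e e' :: "nat \<Rightarrow> 'a" assume *: "\<And>i. i < N \<Longrightarrow> e i = e' i"
    have "(case f j of Inl a \<Rightarrow> a | Inr i \<Rightarrow> e i) = (case f j of Inl a \<Rightarrow> a | Inr i \<Rightarrow> e' i)"
      if "j < n" for j
    proof (cases "f j")
      case (Inr i)
      then have "i < N" using that by (intro N) (auto simp: image_iff intro!: bexI[of _ j])
      then show ?thesis using Inr * by simp
    qed simp
    then show "P e \<longleftrightarrow> P e'" unfolding P by (intro sat_cong[OF n])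
  qed
qed

lemma definable_ex_finite:
  assumes "finite F" "definable P"
  shows "definable (\<lambda>e. \<exists>e'. P (\<lambda>i. if i \<in> F then e' i else e i))"
  using assms
proof (induction F arbitrary: P rule: finite_induct)
  case (insert x F)
  let ?Q = "\<lambda>e. \<exists>e'. P (\<lambda>i. if i \<in> F then e' i else e i)"
  have Q: "definable ?Q" by (rule insert.IH[OF insert.prems])
  have "definable (\<lambda>e. \<exists>a. ?Q (\<lambda>i. if i = x then a else e i))"
    using definable_subst[OF Q, of "\<lambda>i. if i = x then (\<lambda>e. e 0) else (\<lambda>e. e (Suc i))"]
    by (intro definable_ex) (simp add: coord_var if_distrib[where f = "\<lambda>g. g _"] cong: if_cong)
  moreover have "(\<exists>a. ?Q (\<lambda>i. if i = x then a else e i)) \<longleftrightarrow>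
      (\<exists>e'. P (\<lambda>i. if i \<in> insert x F then e' i else e i))" for e
  proof
    assume "\<exists>a. ?Q (\<lambda>i. if i = x then a else e i)"
    then obtain a e' where *: "P (\<lambda>i. if i \<in> F then e' i else if i = x then a else e i)" by blast
    have "(\<lambda>i. if i \<in> F then e' i else if i = x then a else e i) =
        (\<lambda>i. if i \<in> insert x F then (e'(x := a)) i else e i)"
      using insert.hyps by (auto simp: fun_eq_iff)
    with * have "P (\<lambda>i. if i \<in> insert x F then (e'(x := a)) i else e i)" by simp
    then show "\<exists>e'. P (\<lambda>i. if i \<in> insert x F then e' i else e i)"
      by (intro exI[of _ "e'(x := a)"])
  next
    assume "\<exists>e'. P (\<lambda>i. if i \<in> insert x F then e' i else e i)"
    then obtain e' where *: "P (\<lambda>i. if i \<in> insert x F then e' i else e i)" by blast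
    have "(\<lambda>i. if i \<in> insert x F then e' i else e i) =
        (\<lambda>i. if i \<in> F then e' i else if i = x then e' x else e i)"
      by (auto simp: fun_eq_iff)
    with * have "P (\<lambda>i. if i \<in> F then e' i else if i = x then e' x else e i)" by simp
    then show "\<exists>a. ?Q (\<lambda>i. if i = x then a else e i)" by (intro exI)
  qed
  ultimately show ?case by simp
qed simp

text \<open>A definable predicate depends on finitely many coordinates, so the quantifier over all
  environments is a finite block of quantifiers over elements.\<close>

lemma definable_projection:
  assumes C: "definable (\<lambda>e. C (e 0) (\<lambda>i. e (Suc i)))" and coord: "coord t" "coord u"
  shows "definable (\<lambda>e. \<exists>e'. C (t e) e' \<and> e' x = u e)"
proof -
  obtain N where N: "\<And>e e'. (\<And>i. i < N \<Longrightarrow> e i = e' i) \<Longrightarrow>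
      C (e 0) (\<lambda>i. e (Suc i)) \<longleftrightarrow> C (e' 0) (\<lambda>i. e' (Suc i))"
    using definable_support[OF C] by blast
  define F where "F = {..<N} - {0, Suc x}"
  let ?mix = "\<lambda>e e' i. if i \<in> F then e' i else (e i :: 'a)"
  have "definable (\<lambda>e. \<exists>e'. C (?mix e e' 0) (\<lambda>i. ?mix e e' (Suc i)))"
    using definable_ex_finite[OF _ C, of F] by (simp add: F_def)
  moreover have "(\<exists>e'. C (?mix e e' 0) (\<lambda>i. ?mix e e' (Suc i))) \<longleftrightarrow>
      (\<exists>e'. C (e 0) e' \<and> e' x = e (Suc x))" for e
  proof
    assume "\<exists>e'. C (?mix e e' 0) (\<lambda>i. ?mix e e' (Suc i))"
    then obtain e' where "C (?mix e e' 0) (\<lambda>i. ?mix e e' (Suc i))" ..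
    then show "\<exists>e'. C (e 0) e' \<and> e' x = e (Suc x)"
      by (intro exI[of _ "\<lambda>i. ?mix e e' (Suc i)"]) (simp add: F_def)
  next
    assume "\<exists>e'. C (e 0) e' \<and> e' x = e (Suc x)"
    then obtain e' where e': "C (e 0) e'" "e' x = e (Suc x)" by blast
    let ?m = "?mix e (case_nat (e 0) e')"
    have "C (?m 0) (\<lambda>i. ?m (Suc i)) \<longleftrightarrow>
        C (case_nat (e 0) e' 0) (\<lambda>i. case_nat (e 0) e' (Suc i))"
      by (rule N) (auto simp: F_def e'(2) split: nat.split)
    then show "\<exists>e'. C (?mix e e' 0) (\<lambda>i. ?mix e e' (Suc i))"
      using e'(1) by (intro exI[of _ "case_nat (e 0) e'"]) simp
  qed
  ultimately have "definable (\<lambda>e. \<exists>e'. C (e 0) e' \<and> e' x = e (Suc x))" by simp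
  from definable_subst[OF this, of "\<lambda>i. if i = 0 then t else u"] coord show ?thesis by simp
qed


section \<open>Natural numbers in a model of ZF\<close>

lemma E_extensional: "(\<And>z. E z x \<longleftrightarrow> E z y) \<Longrightarrow> x = y"
  using ZF[of Extensionality "\<lambda>_. x"] by (auto simp: ZF_def sat_Extensionality)

lemma ex_pair: "\<exists>p. \<forall>z. E z p \<longleftrightarrow> z = x \<or> z = y"
  using ZF[of Pairing "\<lambda>_. x"] by (auto simp: ZF_def sat_Pairing)

lemma ex_union: "\<exists>u. \<forall>z. E z u \<longleftrightarrow> (\<exists>y. E y x \<and> E z y)"
  using ZF[of Union_Set "\<lambda>_. x"] by (auto simp: ZF_def sat_Union_Set)

lemma E_irrefl: "\<not> E x x"
proof
  assume "E x x"
  obtain p where p: "\<And>z. E z p \<longleftrightarrow> z = x \<or> z = x" using ex_pair by blast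
  have "Foundation \<in> ZF" by (simp add: ZF_def)
  from ZF[OF this, unfolded sat_Foundation, rule_format, of p] p
  have "\<exists>y. E y p \<and> (\<forall>z. E z p \<longrightarrow> \<not> E z y)" by metis
  then obtain y where "E y p" and y: "\<forall>z. E z p \<longrightarrow> \<not> E z y" by blast
  then have "y = x" "E x p" using p by auto
  then show False using y \<open>E x x\<close> by blast
qed

text \<open>This form of Separation is stated for a definable predicate, so that no formula has to be written
  down when it is used.\<close>

lemma ex_separation:
  assumes "definable (\<lambda>e. Q (e 0))"
  shows "\<exists>B. \<forall>x. E x B \<longleftrightarrow> E x A \<and> Q x"
proof -
  obtain \<phi> and f :: "nat \<Rightarrow> 'a + nat" where \<phi>: "in_fm \<phi>"
    and Q: "\<And>e. Q (e 0) \<longleftrightarrow> holds (\<lambda>j. case f j of Inl a \<Rightarrow> a | Inr i \<Rightarrow> e i) \<phi>"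
    using assms unfolding definable_def by blast
  let ?\<psi> = "subst (\<lambda>j. case f j of Inl _ \<Rightarrow> Suc j | Inr _ \<Rightarrow> 0) \<phi>"
  let ?e = "\<lambda>j. case f j of Inl a \<Rightarrow> a | Inr _ \<Rightarrow> A"
  obtain n where "fv_below n ?\<psi>" using fv_below_ex by blast
  then have "(Forall ^^ n) (separation_fm ?\<psi>) \<in> ZF"
    using \<phi> unfolding ZF_def Separation_def
    by (intro UnI1 UnI2 CollectI exI[of _ n] exI[of _ ?\<psi>]) (auto intro: fv_below_mono)
  then have "holds ?e (separation_fm ?\<psi>)" by (intro sat_Foralls[OF ZF])
  moreover have "holds (case_nat x ?e) ?\<psi> \<longleftrightarrow> Q x" for x
  proof -
    have "(\<lambda>j. case_nat x ?e (case f j of Inl _ \<Rightarrow> Suc j | Inr _ \<Rightarrow> 0)) =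
        (\<lambda>j. case f j of Inl a \<Rightarrow> a | Inr i \<Rightarrow> x)"
      by (auto simp: fun_eq_iff split: sum.split)
    then show ?thesis using Q[of "\<lambda>_. x"] by (simp add: sat_subst)
  qed
  ultimately show ?thesis by (simp add: sat_separation_fm)
qed

abbreviation nn :: "'a \<Rightarrow> bool" where
  "nn \<equiv> is_nat E"

abbreviation zero :: "'a \<Rightarrow> bool" where
  "zero x \<equiv> \<forall>z. \<not> E z x"

abbreviation sc :: "'a \<Rightarrow> 'a \<Rightarrow> bool" where
  "sc x y \<equiv> \<forall>z. E z y \<longleftrightarrow> E z x \<or> z = x"

lemma sc_ex: "\<exists>y. sc x y"
proof -
  obtain p where "\<And>z. E z p \<longleftrightarrow> z = x \<or> z = x" using ex_pair by blast
  moreover obtain q where "\<And>z. E z q \<longleftrightarrow> z = x \<or> z = p" using ex_pair by blast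
  moreover obtain y where "\<And>z. E z y \<longleftrightarrow> (\<exists>w. E w q \<and> E z w)" using ex_union by blast
  ultimately have "sc x y" by metis
  then show ?thesis ..
qed

lemma sc_unique: "sc x y \<Longrightarrow> sc x y' \<Longrightarrow> y = y'"
  by (rule E_extensional) blast

lemma zero_unique: "zero x \<Longrightarrow> zero y \<Longrightarrow> x = y"
  by (rule E_extensional) blast

lemma ex_inductive: "\<exists>I. is_inductive E I"
  using ZF[of Infinity] by (auto simp: ZF_def sat_Infinity)

lemma ex_zero: "\<exists>z. zero z"
  using ex_inductive unfolding is_inductive_def by blast

lemma nn_zero: "zero z \<Longrightarrow> nn z"
  using zero_unique unfolding is_nat_def is_inductive_def by metis

lemma nn_sc:
  assumes "nn x" "sc x y"
  shows "nn y"
  unfolding is_nat_def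
proof (intro allI impI)
  fix I assume I: "is_inductive E I"
  then have "E x I" using assms(1) unfolding is_nat_def by blast
  then obtain y' where "sc x y'" "E y' I" using I unfolding is_inductive_def by blast
  then show "E y I" using sc_unique[OF assms(2)] by blast
qed

text \<open>\<open>nn\<close> is the model's own set of natural numbers, which may contain elements that are nonstandard
  from outside. Induction therefore works for definable predicates only.\<close>

lemma nn_induct:
  assumes Q: "definable (\<lambda>e. Q (e 0))" and x: "nn x"
    and 0: "\<And>z. zero z \<Longrightarrow> Q z" and Suc: "\<And>x y. nn x \<Longrightarrow> Q x \<Longrightarrow> sc x y \<Longrightarrow> Q y"
  shows "Q x"
proof -
  obtain I where I: "is_inductive E I" using ex_inductive by blast
  have "definable (\<lambda>e. nn (e 0) \<and> Q (e 0))" by (intro definable_intros Q)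
  from ex_separation[OF this] obtain B where B: "\<And>x. E x B \<longleftrightarrow> E x I \<and> nn x \<and> Q x" by blast
  have "is_inductive E B"
    unfolding is_inductive_def
  proof (intro conjI allI impI)
    obtain z where z: "zero z" "E z I" using I unfolding is_inductive_def by blast
    show "\<exists>z. zero z \<and> E z B"
      using z B 0[OF z(1)] nn_zero[OF z(1)] by (intro exI[of _ z]) simp
    fix x assume x: "E x B"
    then obtain y where y: "sc x y" "E y I" using I B unfolding is_inductive_def by blast
    show "\<exists>y. sc x y \<and> E y B"
      using y x B Suc[OF _ _ y(1)] nn_sc[OF _ y(1)] by (intro exI[of _ y]) simp
  qed
  then show ?thesis using x B unfolding is_nat_def by blast
qed

lemma nn_trans: "nn n \<Longrightarrow> E y n \<Longrightarrow> E z y \<Longrightarrow> E z n"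
proof -
  assume n: "nn n"
  have "\<forall>y z. E y n \<longrightarrow> E z y \<longrightarrow> E z n"
    by (rule nn_induct[OF _ n], intro definable_intros) blast+
  then show "E y n \<Longrightarrow> E z y \<Longrightarrow> E z n" by blast
qed

lemma nn_elem: "nn n \<Longrightarrow> E y n \<Longrightarrow> nn y"
proof -
  assume n: "nn n"
  have "\<forall>y. E y n \<longrightarrow> nn y"
    by (rule nn_induct[OF _ n], intro definable_intros) blast+
  then show "E y n \<Longrightarrow> nn y" by blast
qed

lemma nn_sc_le:
  assumes "nn j" "E k j" "sc k s"
  shows "E s j \<or> s = j"
proof -
  have "\<forall>k s. E k j \<longrightarrow> sc k s \<longrightarrow> E s j \<or> s = j"
  proof (rule nn_induct[OF _ \<open>nn j\<close>], intro definable_intros)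
    fix x y assume IH: "\<forall>k s. E k x \<longrightarrow> sc k s \<longrightarrow> E s x \<or> s = x" and y: "sc x y"
    show "\<forall>k s. E k y \<longrightarrow> sc k s \<longrightarrow> E s y \<or> s = y"
    proof (intro allI impI)
      fix k s assume "E k y" and s: "sc k s"
      then consider "E k x" | "k = x" using y by blast
      then show "E s y \<or> s = y"
      proof cases
        case 1
        then show ?thesis using IH s y by blast
      next
        case 2
        then show ?thesis using sc_unique s y by blast
      qed
    qed
  qed blast
  then show ?thesis using assms by blast
qed

lemma zero_least:
  assumes "zero z" "nn n"
  shows "z = n \<or> E z n"
proof (rule nn_induct[OF _ \<open>nn n\<close>], intro definable_intros)
  show "z = x \<or> E z x" if "zero x" for x using that zero_unique assms(1) by blast
qed blast

lemma nn_linear: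
  assumes k: "nn k" and j: "nn j"
  shows "E k j \<or> k = j \<or> E j k"
proof (rule nn_induct[OF _ j], intro definable_intros)
  show "E k z \<or> k = z \<or> E z k" if "zero z" for z using zero_least[OF that k] by blast
  show "E k y \<or> k = y \<or> E y k" if "E k x \<or> k = x \<or> E x k" "sc x y" for x y
    using that nn_sc_le[OF k, of x y] by blast
qed

text \<open>Inclusion serves as the order of the natural numbers. It is reflexive and transitive for free,
  and agreement of two sets on the elements of \<open>j\<close> implies agreement on those of \<open>k\<close> if
  \<open>le k j\<close>.\<close>

abbreviation le :: "'a \<Rightarrow> 'a \<Rightarrow> bool" where
  "le k j \<equiv> \<forall>z. E z k \<longrightarrow> E z j"

lemma nn_directed:
  assumes "nn k" "nn j"
  shows "\<exists>l. nn l \<and> le k l \<and> le j l"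
  using nn_linear[OF assms] nn_trans[OF assms(1)] nn_trans[OF assms(2)] assms by blast


section \<open>Forcing with definable filter bases\<close>

type_synonym 'b family = "'b \<Rightarrow> (nat \<Rightarrow> 'b) \<Rightarrow> bool"

text \<open>The first coordinate of the defining predicate is the level \<open>k\<close>, the others are the values of
  the names.\<close>

definition condition :: "'a family \<Rightarrow> bool" where
  "condition C \<longleftrightarrow> definable (\<lambda>e. C (e 0) (\<lambda>i. e (Suc i))) \<and>
    (\<forall>k j e. nn k \<longrightarrow> nn j \<longrightarrow> le k j \<longrightarrow> C j e \<longrightarrow> C k e) \<and> (\<forall>k. nn k \<longrightarrow> (\<exists>e. C k e))"

definition ev :: "'a family \<Rightarrow> ((nat \<Rightarrow> 'a) \<Rightarrow> bool) \<Rightarrow> bool" where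
  "ev C P \<longleftrightarrow> (\<exists>k. nn k \<and> (\<forall>e. C k e \<longrightarrow> P e))"

text \<open>Every set of the filter base \<open>C\<close> belongs to the filter generated by \<open>D\<close>.\<close>

definition extends :: "'a family \<Rightarrow> 'a family \<Rightarrow> bool" (infix \<open>\<preceq>\<close> 50) where
  "D \<preceq> C \<longleftrightarrow> condition D \<and> (\<forall>k. nn k \<longrightarrow> ev D (C k))"

lemma extends_condition: "D \<preceq> C \<Longrightarrow> condition D"
  by (simp add: extends_def)

lemma extends_refl: "condition C \<Longrightarrow> C \<preceq> C"
  by (auto simp: extends_def ev_def)

lemma ev_mono: "ev C P \<Longrightarrow> (\<And>e. P e \<Longrightarrow> Q e) \<Longrightarrow> ev C Q"
  unfolding ev_def by blast

lemma ev_all: "(\<And>e. P e) \<Longrightarrow> ev C P"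
  using ex_zero nn_zero unfolding ev_def by blast

lemma ev_conj:
  assumes "condition C" "ev C P" "ev C Q"
  shows "ev C (\<lambda>e. P e \<and> Q e)"
proof -
  obtain k j where k: "nn k" "\<forall>e. C k e \<longrightarrow> P e" and j: "nn j" "\<forall>e. C j e \<longrightarrow> Q e"
    using assms unfolding ev_def by blast
  obtain l where "nn l" "le k l" "le j l" using nn_directed[OF k(1) j(1)] by blast
  moreover from this have "C l e \<longrightarrow> C k e" "C l e \<longrightarrow> C j e" for e
    using assms(1) k(1) j(1) unfolding condition_def by blast+
  ultimately show ?thesis using k(2) j(2) unfolding ev_def by blast
qed

lemma ev_ex: "condition C \<Longrightarrow> ev C P \<Longrightarrow> \<exists>e. P e"
  unfolding condition_def ev_def by blast

lemma ev_extends: "D \<preceq> C \<Longrightarrow> ev C P \<Longrightarrow> ev D P"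
  unfolding extends_def ev_def by blast

lemma extends_trans: "D' \<preceq> D \<Longrightarrow> D \<preceq> C \<Longrightarrow> D' \<preceq> C"
  using ev_extends unfolding extends_def by blast

text \<open>The generic way to strengthen a condition: cut down each level.\<close>

lemma extends_level:
  assumes C: "condition C" and P: "definable (\<lambda>e. P (e 0) (\<lambda>i. e (Suc i)))"
    and mono: "\<And>k j e. nn k \<Longrightarrow> nn j \<Longrightarrow> le k j \<Longrightarrow> P j e \<Longrightarrow> P k e"
    and ne: "\<And>k. nn k \<Longrightarrow> \<exists>e. C k e \<and> P k e"
  shows "(\<lambda>k e. C k e \<and> P k e) \<preceq> C"
proof -
  have "condition (\<lambda>k e. C k e \<and> P k e)"
    using C mono ne unfolding condition_def by (intro conjI definable_conj P) blast+
  then show ?thesis unfolding extends_def ev_def by blast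
qed

lemma extends_restrict:
  assumes C: "condition C" and P: "definable P" and ne: "\<not> ev C (\<lambda>e. \<not> P e)"
  shows "(\<lambda>k e. C k e \<and> P e) \<preceq> C"
proof (rule extends_level[OF C])
  show "definable (\<lambda>e. P (\<lambda>i. e (Suc i)))" by (intro definable_subst[OF P] coord_var)
  show "\<exists>e. C k e \<and> P e" if "nn k" for k using ne that unfolding ev_def by blast
qed

lemma ev_restrict: "ev (\<lambda>k e. C k e \<and> P e) P"
  using ex_zero nn_zero unfolding ev_def by blast

text \<open>If \<open>P\<close> does not hold eventually, then its failure can be imposed on all levels, and no extension
  of the condition obtained in this way makes \<open>P\<close> hold eventually.\<close>

lemma ev_dense:
  assumes C: "condition C" and P: "definable P" and dense: "\<And>D. D \<preceq> C \<Longrightarrow> \<exists>D'. D' \<preceq> D \<and> ev D' P"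
  shows "ev C P"
proof (rule ccontr)
  assume "\<not> ev C P"
  then have "(\<lambda>k e. C k e \<and> \<not> P e) \<preceq> C"
    by (intro extends_restrict C definable_not P) simp
  then obtain D' where D': "D' \<preceq> (\<lambda>k e. C k e \<and> \<not> P e)" "ev D' P" using dense by blast
  have "ev D' (\<lambda>e. \<not> P e)" using ev_extends[OF D'(1) ev_restrict] .
  with D' have "ev D' (\<lambda>e. \<not> P e \<and> P e)" by (intro ev_conj) (auto dest: extends_condition)
  then show False using ev_ex D' extends_condition by blast
qed

text \<open>A definable family constrains finitely many names only. The bound \<open>M\<close> serves to avoid the names
  that are already in use.\<close>

lemma condition_fresh:
  assumes "condition C"
  obtains x where "x \<ge> M" "\<And>k e a. C k (e(x := a)) \<longleftrightarrow> C k e"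
proof -
  obtain N where N: "\<And>e e'. (\<And>i. i < N \<Longrightarrow> e i = e' i) \<Longrightarrow>
      C (e 0) (\<lambda>i. e (Suc i)) \<longleftrightarrow> C (e' 0) (\<lambda>i. e' (Suc i))"
    using assms definable_support[of "\<lambda>e. C (e 0) (\<lambda>i. e (Suc i))"] unfolding condition_def by blast
  have "C k (e(max M N := a)) \<longleftrightarrow> C k e" for k e a
  proof -
    have "C (case_nat k (e(max M N := a)) 0) (\<lambda>i. case_nat k (e(max M N := a)) (Suc i)) \<longleftrightarrow>
        C (case_nat k e 0) (\<lambda>i. case_nat k e (Suc i))"
      by (rule N) (auto split: nat.split)
    then show ?thesis by (simp add: fun_upd_def)
  qed
  then show thesis using that[of "max M N"] by simp
qed

lemma extends_assign:
  assumes C: "condition C" and x: "\<And>k e a. C k (e(x := a)) \<longleftrightarrow> C k e"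
  shows "(\<lambda>k e. C k e \<and> e x = a) \<preceq> C"
proof (rule extends_restrict[OF C])
  show "definable (\<lambda>e. e x = a)" by (intro definable_intros)
  show "\<not> ev C (\<lambda>e. e x \<noteq> a)"
  proof
    assume "ev C (\<lambda>e. e x \<noteq> a)"
    then obtain k where k: "nn k" "\<forall>e. C k e \<longrightarrow> e x \<noteq> a" unfolding ev_def by blast
    then obtain e where "C k e" using C unfolding condition_def by blast
    then have "C k (e(x := a))" using x by simp
    then show False using k(2) by fastforce
  qed
qed

text \<open>Weak forcing: since a formula is forced as soon as it is forced densely (\<open>forces_dense\<close>),
  classical logic is sound for it. The variables of the formula are interpreted by names through
  \<open>v\<close>.\<close>

primrec forces :: "'a family \<Rightarrow> (nat \<Rightarrow> nat) \<Rightarrow> fm \<Rightarrow> bool" where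
  "forces C v (x \<^bold>\<in> y) = ev C (\<lambda>e. E (e (v x)) (e (v y)))"
| "forces C v (x \<^bold>= y) = ev C (\<lambda>e. e (v x) = e (v y))"
| "forces C v (St x) = (\<forall>D. D \<preceq> C \<longrightarrow> (\<exists>D' a. D' \<preceq> D \<and> ev D' (\<lambda>e. e (v x) = a)))"
| "forces C v \<^bold>\<bottom> = False"
| "forces C v (\<phi> \<^bold>\<longrightarrow> \<psi>) = (\<forall>D. D \<preceq> C \<longrightarrow> forces D v \<phi> \<longrightarrow> forces D v \<psi>)"
| "forces C v (Forall \<phi>) = (\<forall>x. forces C (case_nat x v) \<phi>)"

lemma forces_mono: "forces C v \<phi> \<Longrightarrow> D \<preceq> C \<Longrightarrow> forces D v \<phi>"
proof (induction \<phi> arbitrary: v)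
  case (St x)
  then show ?case using extends_trans by (metis forces.simps(3))
next
  case (Imp \<phi> \<psi>)
  then show ?case using extends_trans by (metis forces.simps(5))
qed (auto intro: ev_extends)

lemma forces_dense:
  assumes "condition C" "\<And>D. D \<preceq> C \<Longrightarrow> \<exists>D'. D' \<preceq> D \<and> forces D' v \<phi>"
  shows "forces C v \<phi>"
  using assms
proof (induction \<phi> arbitrary: C v)
  case (Mem x y)
  then show ?case by (auto intro!: ev_dense definable_intros)
next
  case (Eq x y)
  then show ?case by (auto intro!: ev_dense definable_intros)
next
  case (St x)
  show ?case
  proof (simp, intro allI impI)
    fix D assume "D \<preceq> C"
    then obtain D1 where D1: "D1 \<preceq> D" "forces D1 v (St x)" using St.prems by blast
    then obtain D2 a where "D2 \<preceq> D1" "ev D2 (\<lambda>e. e (v x) = a)"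
      using extends_refl extends_condition by (metis forces.simps(3))
    then show "\<exists>D'. D' \<preceq> D \<and> (\<exists>a. ev D' (\<lambda>e. e (v x) = a))"
      using D1(1) extends_trans by blast
  qed
next
  case Fls
  then show ?case using extends_refl by force
next
  case (Imp \<phi> \<psi>)
  show ?case
  proof (simp, intro allI impI)
    fix D assume D: "D \<preceq> C" "forces D v \<phi>"
    show "forces D v \<psi>"
    proof (rule Imp.IH(2))
      show "condition D" using D extends_condition by blast
      fix D1 assume D1: "D1 \<preceq> D"
      then obtain D2 where D2: "D2 \<preceq> D1" "forces D2 v (\<phi> \<^bold>\<longrightarrow> \<psi>)"
        using Imp.prems D extends_trans by blast
      then have "D2 \<preceq> D2" "forces D2 v \<phi>"
        using D(2) D1 extends_trans forces_mono extends_refl extends_condition by blast+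
      then have "forces D2 v \<psi>" using D2(2) by simp
      with D2(1) show "\<exists>D'. D' \<preceq> D1 \<and> forces D' v \<psi>" by blast
    qed
  qed
next
  case (Forall \<phi>)
  show ?case
  proof (simp, intro allI)
    fix x show "forces C (case_nat x v) \<phi>"
      by (rule Forall.IH[OF Forall.prems(1)]) (use Forall.prems(2) in force)
  qed
qed

lemma forces_subst: "forces C v (subst f \<phi>) = forces C (\<lambda>x. v (f x)) \<phi>"
proof (induction \<phi> arbitrary: C v f)
  case (Forall \<phi>)
  have "(\<lambda>x. case_nat a v (case_nat 0 (\<lambda>x. Suc (f x)) x)) = case_nat a (\<lambda>x. v (f x))" for a
    by (auto simp: fun_eq_iff split: nat.split)
  then show ?case by (simp add: Forall)
qed simp_all

lemma forces_inst: "forces C v (inst t \<phi>) = forces C (case_nat (v t) v) \<phi>"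
proof -
  have "(\<lambda>x. v (case_nat t (\<lambda>x. x) x)) = case_nat (v t) v"
    by (auto simp: fun_eq_iff split: nat.split)
  then show ?thesis by (simp add: inst_def forces_subst)
qed

text \<open>This validates the substitution rule for equality.\<close>

lemma forces_names:
  assumes "condition C" "\<And>i. ev C (\<lambda>e. e (v i) = e (w i))" "forces C v \<phi>"
  shows "forces C w \<phi>"
  using assms
proof (induction \<phi> arbitrary: C v w)
  case (Mem x y)
  have "ev C (\<lambda>e. (e (v x) = e (w x) \<and> e (v y) = e (w y)) \<and> E (e (v x)) (e (v y)))"
    using Mem.prems by (intro ev_conj) auto
  then show ?case by (auto elim: ev_mono)
next
  case (Eq x y)
  have "ev C (\<lambda>e. (e (v x) = e (w x) \<and> e (v y) = e (w y)) \<and> e (v x) = e (v y))"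
    using Eq.prems by (intro ev_conj) auto
  then show ?case by (auto elim: ev_mono)
next
  case (St x)
  show ?case
  proof (simp, intro allI impI)
    fix D assume "D \<preceq> C"
    then obtain D' a where D': "D' \<preceq> D" "ev D' (\<lambda>e. e (v x) = a)" using St.prems(3) by auto
    have "ev D' (\<lambda>e. e (v x) = e (w x))"
      using St.prems(2) D' \<open>D \<preceq> C\<close> ev_extends extends_trans by blast
    with D' have "ev D' (\<lambda>e. e (v x) = a \<and> e (v x) = e (w x))"
      by (intro ev_conj) (auto dest: extends_condition)
    then have "ev D' (\<lambda>e. e (w x) = a)" by (auto elim: ev_mono)
    with D' show "\<exists>D'. D' \<preceq> D \<and> (\<exists>a. ev D' (\<lambda>e. e (w x) = a))" by blast
  qed
next
  case (Imp \<phi> \<psi>)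
  show ?case
  proof (simp, intro allI impI)
    fix D assume D: "D \<preceq> C" "forces D w \<phi>"
    have condition: "condition D" using D extends_condition by blast
    have eq: "ev D (\<lambda>e. e (v i) = e (w i))" for i using Imp.prems(2) D ev_extends by blast
    have "ev D (\<lambda>e. e (w i) = e (v i))" for i using eq[of i] by (auto elim: ev_mono)
    then have "forces D v \<phi>" using Imp.IH(1)[OF condition _ D(2)] by blast
    then have "forces D v \<psi>" using Imp.prems(3) D(1) by simp
    with condition eq show "forces D w \<psi>" by (rule Imp.IH(2))
  qed
next
  case (Forall \<phi>)
  show ?case
  proof (simp, intro allI)
    fix x
    have "ev C (\<lambda>e. e (case_nat x v i) = e (case_nat x w i))" for i
      using Forall.prems(2) by (cases i) (auto intro: ev_all)
    then show "forces C (case_nat x w) \<phi>"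
      using Forall.IH[OF Forall.prems(1)] Forall.prems(3) by (metis forces.simps(6))
  qed
qed simp

theorem forces_sound:
  assumes "derives L \<Gamma> \<phi>" "condition C" "\<And>\<gamma>. \<gamma> \<in> \<Gamma> \<Longrightarrow> forces C v \<gamma>"
  shows "forces C v \<phi>"
  using assms
proof (induction arbitrary: C v rule: derives.induct)
  case (ImpI \<phi> \<Gamma> \<psi>)
  show ?case
  proof (simp, intro allI impI)
    fix D assume "D \<preceq> C" "forces D v \<phi>"
    then show "forces D v \<psi>"
      using ImpI.prems(2) extends_condition by (intro ImpI.IH) (auto intro: forces_mono)
  qed
next
  case (ImpE \<Gamma> \<phi> \<psi>)
  then have "forces C v (\<phi> \<^bold>\<longrightarrow> \<psi>)" "forces C v \<phi>" by blast+
  then show ?case using extends_refl[OF ImpE.prems(1)] by simp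
next
  case (Classical \<phi> \<Gamma>)
  show ?case
  proof (rule forces_dense[OF Classical.prems(1)], rule ccontr)
    fix D assume D: "D \<preceq> C" "\<not> (\<exists>D'. D' \<preceq> D \<and> forces D' v \<phi>)"
    then have "forces D v (\<^bold>\<not> \<phi>)" by auto
    then have "forces D v \<^bold>\<bottom>"
      using Classical.prems(2) D(1) extends_condition
      by (intro Classical.IH) (auto intro: forces_mono)
    then show False by simp
  qed
next
  case (ForallI \<Gamma> \<phi>)
  have "forces C (case_nat x v) \<phi>" for x
    using ForallI.prems by (intro ForallI.IH) (auto simp: forces_subst)
  then show ?case by simp
next
  case (ForallE \<Gamma> \<phi> t)
  then show ?case by (auto simp: forces_inst)
next
  case (EqRefl \<Gamma> x)
  then show ?case by (simp add: ev_all)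
next
  case (EqSubst \<Gamma> x y \<phi>)
  then have eq: "forces C v (x \<^bold>= y)" and "forces C (case_nat (v x) v) \<phi>"
    by (auto simp: forces_inst)
  have "ev C (\<lambda>e. e (case_nat (v x) v i) = e (case_nat (v y) v i))" for i
    using eq by (cases i) (auto intro: ev_all)
  from forces_names[OF EqSubst.prems(1) this \<open>forces C (case_nat (v x) v) \<phi>\<close>]
  show ?case by (simp add: forces_inst)
qed

text \<open>The theorem of Los for the extension. In the step for \<open>Forall\<close>, if a counterexample exists at
  every level, then an unused name can take these counterexamples as its values; as it is
  unused, changing its value does not leave the condition.\<close>

theorem forces_in_fm:
  assumes "condition C" "in_fm \<phi>"
  shows "forces C v \<phi> \<longleftrightarrow> ev C (\<lambda>e. holds (\<lambda>i. e (v i)) \<phi>)"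
  using assms
proof (induction \<phi> arbitrary: C v)
  case Fls
  then show ?case using ev_ex by auto
next
  case (Imp \<phi> \<psi>)
  let ?P = "\<lambda>\<chi> e. holds (\<lambda>i. e (v i)) \<chi>"
  show ?case
  proof
    assume f: "forces C v (\<phi> \<^bold>\<longrightarrow> \<psi>)"
    show "ev C (?P (\<phi> \<^bold>\<longrightarrow> \<psi>))"
    proof (rule ccontr)
      assume not: "\<not> ev C (?P (\<phi> \<^bold>\<longrightarrow> \<psi>))"
      let ?D = "\<lambda>k e. C k e \<and> \<not> ?P (\<phi> \<^bold>\<longrightarrow> \<psi>) e"
      have D: "?D \<preceq> C"
        using not Imp.prems by (intro extends_restrict definable_not definable_holds coord_var) simp_all
      then have condition: "condition ?D" by (rule extends_condition)
      have *: "ev ?D (\<lambda>e. \<not> ?P (\<phi> \<^bold>\<longrightarrow> \<psi>) e)" by (rule ev_restrict)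
      then have "ev ?D (?P \<phi>)" by (auto elim!: ev_mono)
      then have "forces ?D v \<phi>" using Imp.IH(1)[OF condition] Imp.prems by simp
      then have "forces ?D v \<psi>" using f D by simp
      then have "ev ?D (?P \<psi>)" using Imp.IH(2)[OF condition] Imp.prems by simp
      from ev_ex[OF condition ev_conj[OF condition this *]] show False by auto
    qed
  next
    assume ev: "ev C (?P (\<phi> \<^bold>\<longrightarrow> \<psi>))"
    show "forces C v (\<phi> \<^bold>\<longrightarrow> \<psi>)"
    proof (simp, intro allI impI)
      fix D assume D: "D \<preceq> C" "forces D v \<phi>"
      have condition: "condition D" using D extends_condition by blast
      have "ev D (?P \<phi>)" using Imp.IH(1)[OF condition] Imp.prems D by simp
      with ev_extends[OF D(1) ev] have "ev D (\<lambda>e. ?P (\<phi> \<^bold>\<longrightarrow> \<psi>) e \<and> ?P \<phi> e)"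
        by (rule ev_conj[OF condition])
      then have "ev D (?P \<psi>)" by (auto elim!: ev_mono)
      then show "forces D v \<psi>" using Imp.IH(2)[OF condition] Imp.prems by simp
    qed
  qed
next
  case (Forall \<phi>)
  have case_comp: "(\<lambda>i. e (case_nat x v i)) = case_nat (e x) (\<lambda>i. e (v i))" for x and e :: "nat \<Rightarrow> 'a"
    by (auto simp: fun_eq_iff split: nat.split)
  have IH: "forces D (case_nat x v) \<phi> \<longleftrightarrow> ev D (\<lambda>e. holds (case_nat (e x) (\<lambda>i. e (v i))) \<phi>)"
    if "condition D" for D x
    using Forall.IH[OF that, of "case_nat x v"] Forall.prems by (simp add: case_comp)
  show ?case
  proof
    assume f: "forces C v (Forall \<phi>)"
    show "ev C (\<lambda>e. holds (\<lambda>i. e (v i)) (Forall \<phi>))"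
    proof (rule ccontr)
      assume not: "\<not> ?thesis"
      obtain n where n: "fv_below n (Forall \<phi>)" using fv_below_ex by blast
      obtain M where M: "\<And>i. i < n \<Longrightarrow> v i < M"
        using finite_nat_set_iff_bounded[of "v ` {..<n}"] by auto
      obtain x where x: "x \<ge> M" "\<And>k e a. C k (e(x := a)) \<longleftrightarrow> C k e"
        by (rule condition_fresh[OF Forall.prems(1), of M]) (rule that; assumption)
      have "ev C (\<lambda>e. holds (case_nat (e x) (\<lambda>i. e (v i))) \<phi>)"
        using IH[OF Forall.prems(1)] f by simp
      then obtain k where k: "nn k" "\<And>e. C k e \<Longrightarrow> holds (case_nat (e x) (\<lambda>i. e (v i))) \<phi>"
        unfolding ev_def by blast
      obtain e a where e: "C k e" "\<not> holds (case_nat a (\<lambda>i. e (v i))) \<phi>"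
        using not k(1) unfolding ev_def by auto
      have "holds (case_nat a (\<lambda>i. (e(x := a)) (v i))) \<phi>"
        using k(2)[of "e(x := a)"] x(2) e(1) by simp
      moreover have "holds (case_nat a (\<lambda>i. (e(x := a)) (v i))) \<phi> \<longleftrightarrow>
          holds (case_nat a (\<lambda>i. e (v i))) \<phi>"
        by (rule sat_cong[of "Suc n"])
          (use n M x(1) in \<open>auto simp: less_Suc_eq_0_disj dest: leD M\<close>)
      ultimately show False using e(2) by simp
    qed
  next
    assume "ev C (\<lambda>e. holds (\<lambda>i. e (v i)) (Forall \<phi>))"
    then show "forces C v (Forall \<phi>)" using IH[OF Forall.prems(1)] by (auto elim!: ev_mono)
  qed
qed simp_all


section \<open>The axioms of SPOT are forced\<close>

lemma forces_conj:
  assumes "forces C v \<phi>" "forces C v \<psi>"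
  shows "forces C v (\<phi> \<^bold>\<and> \<psi>)"
  unfolding forces.simps(5)[of _ _ "\<phi> \<^bold>\<longrightarrow> \<^bold>\<not> \<psi>"]
proof (intro allI impI)
  fix D assume D: "D \<preceq> C" "forces D v (\<phi> \<^bold>\<longrightarrow> \<^bold>\<not> \<psi>)"
  then have "D \<preceq> D" "forces D v \<phi>" "forces D v \<psi>"
    using assms forces_mono extends_refl extends_condition by blast+
  moreover from this have "forces D v (\<^bold>\<not> \<psi>)" using D(2) by simp
  ultimately show "forces D v \<^bold>\<bottom>" by simp
qed

lemma forces_exI:
  assumes "forces C (case_nat x v) \<phi>"
  shows "forces C v (Exists \<phi>)"
  unfolding forces.simps(5)[of _ _ "Forall (\<^bold>\<not> \<phi>)"]
proof (intro allI impI)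
  fix D assume D: "D \<preceq> C" "forces D v (Forall (\<^bold>\<not> \<phi>))"
  then have "D \<preceq> D" "forces D (case_nat x v) \<phi>"
    using assms forces_mono extends_refl extends_condition by blast+
  moreover have "forces D (case_nat x v) (\<^bold>\<not> \<phi>)" using D(2) by simp
  ultimately show "forces D v \<^bold>\<bottom>" by simp
qed

lemma forces_St_obtain:
  assumes "condition C" "forces C v (St x)"
  obtains D a where "D \<preceq> C" "ev D (\<lambda>e. e (v x) = a)"
  using assms extends_refl by (metis forces.simps(3))

lemma forces_StI: "ev C (\<lambda>e. e (v x) = a) \<Longrightarrow> forces C v (St x)"
  by (auto intro: ev_extends extends_refl extends_condition)

text \<open>The unused name \<open>x\<close> is required to include \<open>k\<close> at level \<open>k\<close>. If it were equal to a standard \<open>a\<close>,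
  then at the level of the successor of \<open>a\<close> it would follow that \<open>a \<in> a\<close>.\<close>

lemma forces_Nontriviality:
  assumes "condition C"
  shows "forces C v Nontriviality"
proof (rule forces_dense[OF assms])
  fix D assume "D \<preceq> C"
  then have D: "condition D" by (rule extends_condition)
  obtain x where "x \<ge> 0" and x: "\<And>k e a. D k (e(x := a)) \<longleftrightarrow> D k e"
    by (rule condition_fresh[OF D, of 0]) (rule that; assumption)
  let ?P = "\<lambda>k e. nn (e x) \<and> le k (e x)"
  let ?D' = "\<lambda>k e. D k e \<and> ?P k e"
  have D': "?D' \<preceq> D"
  proof (rule extends_level[OF D])
    fix k assume k: "nn k"
    then obtain e where "D k e" using D unfolding condition_def by blast
    then have "D k (e(x := k)) \<and> ?P k (e(x := k))" using k x by simp
    then show "\<exists>e. D k e \<and> ?P k e" by blast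
  qed (intro definable_intros, blast)
  have nat: "ev ?D' (\<lambda>e. nn (e x))" using ex_zero nn_zero unfolding ev_def by blast
  have nst: "\<not> forces D3 (case_nat z (case_nat x v)) (0 \<^bold>= 1)"
    if D1: "D1 \<preceq> ?D'" "forces D1 (case_nat z (case_nat x v)) (St 0)"
      and D2: "D2 \<preceq> D1" "forces D2 (case_nat z (case_nat x v)) (nat_fm 0)"
      and D3: "D3 \<preceq> D2" for D1 D2 D3 z
  proof
    assume eq: "forces D3 (case_nat z (case_nat x v)) (0 \<^bold>= 1)"
    have le: "D3 \<preceq> ?D'" "D3 \<preceq> D1" using D1(1) D2(1) D3 extends_trans by blast+
    have "forces D3 (case_nat z (case_nat x v)) (St 0)" using D1(2) le(2) by (rule forces_mono)
    then obtain D4 a where D4: "D4 \<preceq> D3" "ev D4 (\<lambda>e. e z = a)"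
      using forces_St_obtain[OF extends_condition[OF D3], of "case_nat z (case_nat x v)" 0] by auto
    have c4: "condition D4" using D4 extends_condition by blast
    have "ev D2 (\<lambda>e. nn (e z))"
      using D2 forces_in_fm[OF extends_condition in_fm_nat_fm] by (simp add: sat_nat_fm)
    then have "ev D4 (\<lambda>e. nn (e z))" using D4(1) D3 ev_extends extends_trans by blast
    from ev_ex[OF c4 ev_conj[OF c4 this D4(2)]] have a: "nn a" by blast
    obtain s where s: "sc a s" using sc_ex by blast
    have "ev ?D' (\<lambda>e. le s (e x))" using nn_sc[OF a s] unfolding ev_def by blast
    then have "ev D4 (\<lambda>e. le s (e x))" using D4(1) le(1) ev_extends extends_trans by blast
    moreover have "ev D4 (\<lambda>e. e z = e x)" using eq D4(1) ev_extends by simp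
    ultimately have "ev D4 (\<lambda>e. (e z = e x \<and> le s (e x)) \<and> e z = a)"
      using D4(2) by (intro ev_conj c4)
    from ev_ex[OF c4 this] have "le s a" by auto
    then show False using s E_irrefl by blast
  qed
  have "forces ?D' v Nontriviality"
    unfolding Nontriviality_def
  proof (rule forces_exI[of _ x], rule forces_conj)
    show "forces ?D' (case_nat x v) (nat_fm 0)"
      using nat by (simp add: forces_in_fm[OF extends_condition[OF D'] in_fm_nat_fm] sat_nat_fm)
    show "forces ?D' (case_nat x v) (ForallSt (nat_fm 0 \<^bold>\<longrightarrow> \<^bold>\<not> 0 \<^bold>= 1))"
      using nst by (simp only: forces.simps) blast
  qed
  with D' show "\<exists>D'. D' \<preceq> D \<and> forces D' v Nontriviality" by blast
qed

text \<open>The Koenig argument behind Standard Part. Here \<open>W k a\<close> says that \<open>a\<close> is a value of a given name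
  at level \<open>k\<close>. The branch \<open>B\<close> leaves out \<open>j\<close> if at all levels some value
  that agrees with \<open>B\<close> below \<open>j\<close> leaves it out (\<open>H j B\<close>), and contains \<open>j\<close> otherwise. In the latter
  case all values of some level that agree with \<open>B\<close> below \<open>j\<close> contain \<open>j\<close>, and by directedness
  every level has such a value in common with that level. The choice at each
  \<open>j\<close> is canonical, so \<open>B\<close> is definable by means of its initial segments (\<open>path\<close>).\<close>

lemma standard_part_trace:
  assumes W: "definable (\<lambda>e. W (e 0) (e 1))" and ne: "\<And>k. nn k \<Longrightarrow> \<exists>a. W k a"
    and mono: "\<And>k j a. nn k \<Longrightarrow> nn j \<Longrightarrow> le k j \<Longrightarrow> W j a \<Longrightarrow> W k a"
  shows "\<exists>B. (\<forall>z. E z B \<longrightarrow> nn z) \<and>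
    (\<forall>k m. nn k \<longrightarrow> nn m \<longrightarrow> (\<exists>a. W k a \<and> (\<forall>z. E z m \<longrightarrow> (E z a \<longleftrightarrow> E z B))))"
proof -
  define H where "H j s \<longleftrightarrow> (\<forall>k. nn k \<longrightarrow>
    (\<exists>a. W k a \<and> (\<forall>z. E z j \<longrightarrow> (E z a \<longleftrightarrow> E z s)) \<and> \<not> E j a))" for j s
  define path where "path m s \<longleftrightarrow> (\<forall>j. E j m \<longrightarrow> (E j s \<longleftrightarrow> \<not> H j s))" for m s
  have W': "definable (\<lambda>e. W (t e) (u e))" if "coord t" "coord u" for t u
    using definable_subst[OF W, of "\<lambda>i. if i = 0 then t else u"] that by simp
  have H': "definable (\<lambda>e. H (t e) (u e))" if "coord t" "coord u" for t u
  proof -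
    have "definable (\<lambda>e. H (e 0) (e 1))" unfolding H_def by (intro definable_intros W')
    from definable_subst[OF this, of "\<lambda>i. if i = 0 then t else u"] that show ?thesis by simp
  qed
  have path': "definable (\<lambda>e. path (t e) (u e))" if "coord t" "coord u" for t u
  proof -
    have "definable (\<lambda>e. path (e 0) (e 1))" unfolding path_def by (intro definable_intros H')
    from definable_subst[OF this, of "\<lambda>i. if i = 0 then t else u"] that show ?thesis by simp
  qed
  have H_cong: "H j s \<longleftrightarrow> H j s'" if "\<forall>z. E z j \<longrightarrow> (E z s \<longleftrightarrow> E z s')" for j s s'
    using that unfolding H_def by simp
  have path_unique: "\<forall>z. E z m \<longrightarrow> (E z s \<longleftrightarrow> E z s')" if m: "nn m" and "path m s" "path m s'" for m s s'
  proof -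
    have "path m s \<longrightarrow> path m s' \<longrightarrow> (\<forall>z. E z m \<longrightarrow> (E z s \<longleftrightarrow> E z s'))"
    proof (rule nn_induct[OF _ m], intro definable_intros path')
      fix x y
      assume IH: "path x s \<longrightarrow> path x s' \<longrightarrow> (\<forall>z. E z x \<longrightarrow> (E z s \<longleftrightarrow> E z s'))" and y: "sc x y"
      show "path y s \<longrightarrow> path y s' \<longrightarrow> (\<forall>z. E z y \<longrightarrow> (E z s \<longleftrightarrow> E z s'))"
      proof (intro impI)
        assume p: "path y s" "path y s'"
        then have "path x s" "path x s'" using y unfolding path_def by auto
        then have agree: "\<forall>z. E z x \<longrightarrow> (E z s \<longleftrightarrow> E z s')" using IH by simp
        have "E x s \<longleftrightarrow> E x s'" using p y H_cong[OF agree] unfolding path_def by simp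
        then show "\<forall>z. E z y \<longrightarrow> (E z s \<longleftrightarrow> E z s')" using agree y by auto
      qed
    qed simp
    then show ?thesis using that by simp
  qed
  obtain w where w: "is_inductive E w" using ex_inductive by blast
  have "definable (\<lambda>e. nn (e 0) \<and> (\<exists>s. path (e 0) s \<and> \<not> H (e 0) s))"
    by (intro definable_intros path' H')
  from ex_separation[OF this, of w] w
  obtain B where B: "\<And>j. E j B \<longleftrightarrow> nn j \<and> (\<exists>s. path j s \<and> \<not> H j s)"
    unfolding is_nat_def by metis
  define good where "good m \<longleftrightarrow> (\<forall>k. nn k \<longrightarrow> (\<exists>a. W k a \<and> (\<forall>z. E z m \<longrightarrow> (E z a \<longleftrightarrow> E z B))))" for m
  have "path m B \<and> good m" if m: "nn m" for m
  proof (rule nn_induct[OF _ m])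
    show "definable (\<lambda>e. path (e 0) B \<and> good (e 0))"
      unfolding good_def by (intro definable_intros path' W')
    show "path z B \<and> good z" if "zero z" for z
      using that ne unfolding path_def good_def by simp
    fix x y assume x: "nn x" and IH: "path x B \<and> good x" and y: "sc x y"
    have xB: "E x B \<longleftrightarrow> \<not> H x B"
    proof
      assume "E x B"
      then obtain s where "path x s" "\<not> H x s" using B by blast
      then show "\<not> H x B" using H_cong[OF path_unique[OF x, of s B]] IH by simp
    next
      assume "\<not> H x B"
      then show "E x B" using B x IH by blast
    qed
    have "path y B" using IH xB y unfolding path_def by auto
    moreover have "good y"
      unfolding good_def
    proof (intro allI impI)
      fix k assume k: "nn k"
      show "\<exists>a. W k a \<and> (\<forall>z. E z y \<longrightarrow> (E z a \<longleftrightarrow> E z B))"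
      proof (cases "H x B")
        case True
        then obtain a where "W k a" "\<forall>z. E z x \<longrightarrow> (E z a \<longleftrightarrow> E z B)" "\<not> E x a"
          using k unfolding H_def by blast
        then show ?thesis using True xB y by auto
      next
        case False
        then obtain l where l: "nn l"
          "\<And>a. W l a \<Longrightarrow> \<forall>z. E z x \<longrightarrow> (E z a \<longleftrightarrow> E z B) \<Longrightarrow> E x a"
          unfolding H_def by blast
        obtain j where j: "nn j" "le k j" "le l j" using nn_directed[OF k l(1)] by blast
        then obtain a where a: "W j a" "\<forall>z. E z x \<longrightarrow> (E z a \<longleftrightarrow> E z B)"
          using IH unfolding good_def by blast
        then have "W k a" "W l a" using mono[OF k j(1,2)] mono[OF l(1) j(1,3)] by simp_all
        then show ?thesis using l(2)[of a] a(2) xB False y by auto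
      qed
    qed
    ultimately show "path y B \<and> good y" ..
  qed
  then show ?thesis using B unfolding good_def by (intro exI[of _ B]) simp
qed

text \<open>Besides agreeing with \<open>B\<close> below \<open>k\<close> at level \<open>k\<close>, the condition fixes an unused name \<open>y\<close> for \<open>B\<close>
  itself.\<close>

lemma extends_standard_part:
  assumes C: "condition C"
  obtains D y B where "D \<preceq> C" "\<And>z. E z B \<Longrightarrow> nn z" "ev D (\<lambda>e. e y = B)"
    "\<And>k. nn k \<Longrightarrow> ev D (\<lambda>e. \<forall>z. E z k \<longrightarrow> (E z (e x) \<longleftrightarrow> E z B))"
proof -
  define W where "W k a \<longleftrightarrow> (\<exists>e. C k e \<and> e x = a)" for k a
  have dC: "definable (\<lambda>e. C (e 0) (\<lambda>i. e (Suc i)))" using C by (simp add: condition_def)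
  have "definable (\<lambda>e. W (e 0) (e 1))"
    unfolding W_def by (intro definable_projection dC coord_var)
  moreover have "\<exists>a. W k a" if "nn k" for k
    using C that unfolding W_def condition_def by blast
  moreover have "W k a" if "nn k" "nn j" "le k j" "W j a" for k j a
    using C that unfolding W_def condition_def by blast
  ultimately obtain B where B: "\<And>z. E z B \<Longrightarrow> nn z"
    "\<And>k m. nn k \<Longrightarrow> nn m \<Longrightarrow> \<exists>a. W k a \<and> (\<forall>z. E z m \<longrightarrow> (E z a \<longleftrightarrow> E z B))"
    using standard_part_trace[of W] by blast
  let ?P = "\<lambda>k e. \<forall>z. E z k \<longrightarrow> (E z (e x) \<longleftrightarrow> E z B)"
  let ?C = "\<lambda>k e. C k e \<and> ?P k e"
  have D: "?C \<preceq> C"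
  proof (rule extends_level[OF C])
    show "\<exists>e. C k e \<and> ?P k e" if "nn k" for k using B(2)[OF that that] unfolding W_def by blast
  qed (intro definable_intros, blast)
  obtain y where "y \<ge> 0" and y: "\<And>k e a. ?C k (e(y := a)) \<longleftrightarrow> ?C k e"
    by (rule condition_fresh[OF extends_condition[OF D], of 0]) (rule that; assumption)
  have D': "(\<lambda>k e. ?C k e \<and> e y = B) \<preceq> ?C"
    by (rule extends_assign[OF extends_condition[OF D] y])
  show thesis
  proof (rule that[OF extends_trans[OF D' D] B(1)])
    show "ev (\<lambda>k e. ?C k e \<and> e y = B) (\<lambda>e. e y = B)" by (rule ev_restrict)
    show "ev (\<lambda>k e. ?C k e \<and> e y = B) (?P k)" if "nn k" for k
      using that unfolding ev_def by blast
  qed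
qed

text \<open>A standard natural number becomes a constant \<open>a\<close> after extending the condition; at the level of
  the successor of \<open>a\<close> membership of \<open>a\<close> in the given set and in \<open>B\<close> is the same.\<close>

lemma forces_Standard_Part:
  assumes "condition C"
  shows "forces C v Standard_Part"
proof -
  let ?\<chi> = "ExistsSt (subset_nat_fm 0 \<^bold>\<and> ForallSt (nat_fm 0 \<^bold>\<longrightarrow> (0 \<^bold>\<in> 1 \<^bold>\<longleftrightarrow> 0 \<^bold>\<in> 2)))"
  have "\<exists>D'. D' \<preceq> D \<and> forces D' (case_nat x v) ?\<chi>" if D: "D \<preceq> C" for D x
  proof -
    obtain D' y B where D': "D' \<preceq> D" and B: "\<And>z. E z B \<Longrightarrow> nn z" "ev D' (\<lambda>e. e y = B)"
      "\<And>k. nn k \<Longrightarrow> ev D' (\<lambda>e. \<forall>z. E z k \<longrightarrow> (E z (e x) \<longleftrightarrow> E z B))"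
      by (rule extends_standard_part[OF extends_condition[OF D], of x]) (rule that; assumption)
    have in_sub: "in_fm (subset_nat_fm 0)" by (simp add: subset_nat_fm_def in_fm_nat_fm)
    have sat_sub: "holds e (subset_nat_fm 0) \<longleftrightarrow> (\<forall>z. E z (e 0) \<longrightarrow> nn z)" for e
      by (simp only: subset_nat_fm_def sat.simps connectives sat_nat_fm) simp
    let ?v = "\<lambda>z. case_nat z (case_nat y (case_nat x v))"
    have "forces D3 (?v z) (0 \<^bold>\<in> 1 \<^bold>\<longleftrightarrow> 0 \<^bold>\<in> 2)"
      if D2: "D2 \<preceq> D'" "forces D2 (?v z) (St 0)" and D3: "D3 \<preceq> D2" "forces D3 (?v z) (nat_fm 0)"
      for D2 D3 z
    proof (rule forces_dense)
      show "condition D3" using D3 extends_condition by blast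
      fix D4 assume D4: "D4 \<preceq> D3"
      have "forces D4 (?v z) (St 0)" using D2(2) D3(1) D4 forces_mono extends_trans by blast
      then obtain D5 a where D5: "D5 \<preceq> D4" "ev D5 (\<lambda>e. e z = a)"
        using forces_St_obtain[OF extends_condition[OF D4], of "?v z" 0] by auto
      have c5: "condition D5" using D5 extends_condition by blast
      have le: "D5 \<preceq> D3" "D5 \<preceq> D'" using D5 D4 D3 D2 extends_trans by blast+
      have "forces D5 (?v z) (nat_fm 0)" using D3(2) le(1) by (rule forces_mono)
      then have "ev D5 (\<lambda>e. nn (e z))"
        by (simp add: forces_in_fm[OF c5 in_fm_nat_fm] sat_nat_fm)
      from ev_ex[OF c5 ev_conj[OF c5 this D5(2)]] have a: "nn a" by blast
      obtain s where s: "sc a s" using sc_ex by blast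
      have "ev D5 (\<lambda>e. \<forall>z. E z s \<longrightarrow> (E z (e x) \<longleftrightarrow> E z B))" "ev D5 (\<lambda>e. e y = B)"
        using B(2) B(3)[OF nn_sc[OF a s]] le(2) ev_extends by blast+
      then have "ev D5 (\<lambda>e. ((\<forall>z. E z s \<longrightarrow> (E z (e x) \<longleftrightarrow> E z B)) \<and> e y = B) \<and> e z = a)"
        using D5(2) by (intro ev_conj c5)
      then have "ev D5 (\<lambda>e. E (e z) (e y) \<longleftrightarrow> E (e z) (e x))"
        by (rule ev_mono) (use s in auto)
      then have "forces D5 (?v z) (0 \<^bold>\<in> 1 \<^bold>\<longleftrightarrow> 0 \<^bold>\<in> 2)"
        by (subst forces_in_fm[OF c5])
          (simp, simp only: sat.simps connectives, simp add: case_nat_numeral)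
      with D5(1) show "\<exists>D'. D' \<preceq> D4 \<and> forces D' (?v z) (0 \<^bold>\<in> 1 \<^bold>\<longleftrightarrow> 0 \<^bold>\<in> 2)" by blast
    qed
    then have st: "forces D' (case_nat y (case_nat x v))
        (ForallSt (nat_fm 0 \<^bold>\<longrightarrow> (0 \<^bold>\<in> 1 \<^bold>\<longleftrightarrow> 0 \<^bold>\<in> 2)))"
      by (simp only: forces.simps) blast
    have "forces D' (case_nat x v) ?\<chi>"
    proof (rule forces_exI[of _ y], intro forces_conj)
      show "forces D' (case_nat y (case_nat x v)) (St 0)" using B(2) by (intro forces_StI) simp
      show "forces D' (case_nat y (case_nat x v)) (subset_nat_fm 0)"
        unfolding forces_in_fm[OF extends_condition[OF D'] in_sub] sat_sub
        using B(2) by (rule ev_mono) (use B(1) in simp)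
    qed (rule st)
    with D' show ?thesis by blast
  qed
  then have *: "forces D (case_nat x v) ?\<chi>" if "D \<preceq> C" for D x
    using that by (intro forces_dense extends_condition[OF that]) (blast intro: extends_trans)
  show ?thesis
    unfolding Standard_Part_def using * by (simp only: forces.simps) blast
qed

lemma forces_ForallSts:
  assumes "\<And>D w. D \<preceq> C \<Longrightarrow> (\<And>i. i < n \<Longrightarrow> forces D w (St i)) \<Longrightarrow> forces D w \<chi>" "condition C"
  shows "forces C v ((ForallSt ^^ n) \<chi>)"
  using assms(1)
proof (induction n arbitrary: \<chi>)
  case 0
  then show ?case using extends_refl[OF assms(2)] by simp
next
  case (Suc n)
  have "forces C v ((ForallSt ^^ n) (ForallSt \<chi>))"
  proof (rule Suc.IH)
    fix D w assume D: "D \<preceq> C" "\<And>i. i < n \<Longrightarrow> forces D w (St i)"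
    have "forces D' (case_nat x w) \<chi>" if D': "D' \<preceq> D" "forces D' (case_nat x w) (St 0)" for D' x
    proof (rule Suc.prems)
      show "D' \<preceq> C" using D' D extends_trans by blast
      show "forces D' (case_nat x w) (St i)" if "i < Suc n" for i
      proof (cases i)
        case (Suc i')
        then have "forces D' w (St i')" using D(2) D' that forces_mono by blast
        then show ?thesis using Suc by simp
      qed (use D' in simp)
    qed
    then show "forces D w (ForallSt \<chi>)" by (simp only: forces.simps) blast
  qed
  then show ?case by (simp only: funpow_Suc_right comp_def)
qed

lemma extends_constants:
  assumes "condition C" "\<And>i. i < n \<Longrightarrow> forces C w (St i)"
  shows "\<exists>D a. D \<preceq> C \<and> (\<forall>i<n. ev D (\<lambda>e. e (w i) = a i))"
  using assms(2)
proof (induction n)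
  case 0
  then show ?case using extends_refl[OF assms(1)] by blast
next
  case (Suc n)
  then obtain D a where D: "D \<preceq> C" "\<forall>i<n. ev D (\<lambda>e. e (w i) = a i)" by (metis less_SucI)
  then have "forces D w (St n)" using Suc.prems[of n] forces_mono by blast
  then obtain D' b where D': "D' \<preceq> D" "ev D' (\<lambda>e. e (w n) = b)"
    using forces_St_obtain[OF extends_condition[OF D(1)]] by metis
  have "\<forall>i<Suc n. ev D' (\<lambda>e. e (w i) = (a(n := b)) i)"
    using D(2) D' ev_extends by (auto simp: less_Suc_eq)
  then show ?case using D(1) D'(1) extends_trans by blast
qed

text \<open>Once the parameters are constant, it suffices that \<open>\<phi>\<close> is true in the model at every element \<open>b\<close>.
  This follows from the hypothesis on standard sets, applied to an unused name with value \<open>b\<close>.\<close>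

lemma forces_Transfer:
  assumes C: "condition C" and \<phi>: "in_fm \<phi>" "fv_below (n + 1) \<phi>"
  shows "forces C v ((ForallSt ^^ n) (ForallSt \<phi> \<^bold>\<longrightarrow> Forall \<phi>))"
proof (rule forces_ForallSts[OF _ C])
  fix D w assume D: "D \<preceq> C" "\<And>i. i < n \<Longrightarrow> forces D w (St i)"
  show "forces D w (ForallSt \<phi> \<^bold>\<longrightarrow> Forall \<phi>)"
    unfolding forces.simps(5)[of _ _ "ForallSt \<phi>"]
  proof (intro allI impI)
    fix D1 assume D1: "D1 \<preceq> D" "forces D1 w (ForallSt \<phi>)"
    show "forces D1 w (Forall \<phi>)"
    proof (rule forces_dense)
      show "condition D1" using D1 extends_condition by blast
      fix D2 assume D2: "D2 \<preceq> D1"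
      have "forces D2 w (St i)" if "i < n" for i
        using D(2)[OF that] D1(1) D2 forces_mono extends_trans by blast
      then obtain D3 a where D3: "D3 \<preceq> D2" and a: "\<And>i. i < n \<Longrightarrow> ev D3 (\<lambda>e. e (w i) = a i)"
        using extends_constants[OF extends_condition[OF D2]] by metis
      have c3: "condition D3" using D3 extends_condition by blast
      have vals: "ev D' (\<lambda>e. \<forall>i<m. e (w i) = a i)" if "D' \<preceq> D3" "m \<le> n" for D' m
        using that(2)
      proof (induction m)
        case 0
        show ?case by (rule ev_all) simp
      next
        case (Suc m)
        then have "ev D' (\<lambda>e. (\<forall>i<m. e (w i) = a i) \<and> e (w m) = a m)"
          using a[of m] ev_extends that(1) extends_condition by (intro ev_conj) auto
        then show ?case by (rule ev_mono) (auto simp: less_Suc_eq)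
      qed
      have all: "holds (case_nat b a) \<phi>" for b
      proof -
        obtain y where "y \<ge> 0" and y: "\<And>k e a. D3 k (e(y := a)) \<longleftrightarrow> D3 k e"
          by (rule condition_fresh[OF c3, of 0]) (rule that; assumption)
        let ?D = "\<lambda>k e. D3 k e \<and> e y = b"
        have D4: "?D \<preceq> D3" by (rule extends_assign[OF c3 y])
        have c4: "condition ?D" using D4 extends_condition by blast
        have b: "ev ?D (\<lambda>e. e y = b)" by (rule ev_restrict)
        then have "forces ?D (case_nat y w) (St 0)" by (intro forces_StI) simp
        moreover have "?D \<preceq> D1" using D4 D3 D2 extends_trans by blast
        ultimately have "forces ?D (case_nat y w) \<phi>"
          using D1(2) by (simp only: forces.simps)
        then have "ev ?D (\<lambda>e. holds (\<lambda>i. e (case_nat y w i)) \<phi>)"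
          by (simp only: forces_in_fm[OF c4 \<phi>(1)])
        from ev_ex[OF c4 ev_conj[OF c4 ev_conj[OF c4 this b] vals[OF D4 order_refl]]]
        obtain e where e: "holds (\<lambda>i. e (case_nat y w i)) \<phi>" "e y = b" "\<forall>i<n. e (w i) = a i"
          by blast
        have "holds (\<lambda>i. e (case_nat y w i)) \<phi> \<longleftrightarrow> holds (case_nat b a) \<phi>"
          by (rule sat_cong[OF \<phi>(2)]) (use e in \<open>auto simp: less_Suc_eq_0_disj\<close>)
        with e(1) show ?thesis by simp
      qed
      have "ev D3 (\<lambda>e. holds (\<lambda>i. e (w i)) (Forall \<phi>))"
        using vals[OF extends_refl[OF c3] order_refl]
      proof (rule ev_mono)
        fix e assume e: "\<forall>i<n. e (w i) = a i"
        have "holds (case_nat b (\<lambda>i. e (w i))) \<phi> \<longleftrightarrow> holds (case_nat b a) \<phi>" for b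
          by (rule sat_cong[OF \<phi>(2)]) (use e in \<open>auto simp: less_Suc_eq_0_disj\<close>)
        with all show "holds (\<lambda>i. e (w i)) (Forall \<phi>)" by simp
      qed
      then have "forces D3 w (Forall \<phi>)" using \<phi>(1) by (subst forces_in_fm[OF c3]) simp_all
      with D3 show "\<exists>D'. D' \<preceq> D2 \<and> forces D' w (Forall \<phi>)" by blast
    qed
  qed
qed

lemma forces_SPOT:
  assumes "condition C" "\<gamma> \<in> SPOT"
  shows "forces C v \<gamma>"
  using assms(2) unfolding SPOT_def Transfer_def
proof (elim UnE CollectE exE conjE insertE emptyE)
  assume "\<gamma> \<in> ZF"
  then show ?thesis
    using ZF_in_sentence[of \<gamma>] ZF by (simp add: forces_in_fm[OF assms(1)] ev_all)
qed (use assms(1) in \<open>simp_all add: forces_Transfer forces_Nontriviality forces_Standard_Part\<close>)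

text \<open>The weakest condition, which allows all environments at every level, already forces SPOT.\<close>

theorem SPOT_theorem_holds:
  assumes "in_fm \<theta>" "sentence \<theta>" "SPOT \<turnstile>\<^sub>s\<^sub>t \<theta>"
  shows "holds e \<theta>"
proof -
  let ?C = "\<lambda>k e. True"
  have C: "condition ?C" unfolding condition_def using definable_not[OF definable_False] by simp
  have "forces ?C (\<lambda>_. 0) \<theta>" using forces_sound[OF assms(3) C] forces_SPOT[OF C] by blast
  then have "ev ?C (\<lambda>e. holds (\<lambda>_. e 0) \<theta>)" by (simp add: forces_in_fm[OF C assms(1)])
  from ev_ex[OF C this] obtain e' :: "nat \<Rightarrow> 'a" where "holds (\<lambda>_. e' 0) \<theta>" by blast
  moreover have "holds (\<lambda>_. e' 0) \<theta> \<longleftrightarrow> holds e \<theta>"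
    using assms(2) by (intro sat_cong[of 0]) (simp_all add: sentence_def)
  ultimately show ?thesis by simp
qed

end

section \<open>Conservativity\<close>

theorem theoremA:
  fixes \<theta> :: fm
  assumes "in_fm \<theta>" and "sentence \<theta>"
    and "SPOT \<turnstile>\<^sub>s\<^sub>t \<theta>"
  shows "ZF \<turnstile>\<^sub>\<in> \<theta>"
proof (rule ZF_completeness[OF assms(1,2)])
  fix E :: "nat \<Rightarrow> nat \<Rightarrow> bool"
  assume "\<And>\<gamma> e. \<gamma> \<in> ZF \<Longrightarrow> sat E (\<lambda>_. False) e \<gamma>"
  then interpret zf_model E by unfold_locales
  show "sat E (\<lambda>_. False) (\<lambda>_. 0) \<theta>" by (rule SPOT_theorem_holds[OF assms])
qed

end
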